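(* For $k\ge i\ge1$ and integers $N_1\ge N_2\ge\cdots\ge N_{k-1}\ge0$, there is a bijection $\Phi:\mathbb{F}_{N_1,\dots,N_{k-1};i}\to\mathbb{R}_{N_1-1}\times\mathbb{G}_{N_1,\dots,N_{k-1};i}$ such that whenever $\Phi(\lambda)=(\tau,\mu)$ we have $|\lambda|=|\tau|+|\mu|$.
   Context: An overpartition of $n$ is a partition of $n$ in which the first occurrence of each part size may be overlined. Parts are ordered by $\overline1<1<\overline2<2<\cdots$, and an overpartition is written $\lambda=(\lambda_1,\dots,\lambda_\ell)$ with $\lambda_1\le\cdots\le\lambda_\ell$ in this order; $|\lambda_j|$ is the numerical size of a part, $|\lambda|=\sum_j|\lambda_j|$. For $t\ge1$, $f_t(\lambda)$ (resp. $f_{\overline t}(\lambda)$) is the number of non-overlined (resp. overlined) parts equal to $t$; $f_0=f_{\overline0}=0$. Göllnitz–Gordon marking: marks are assigned to $\lambda_1,\dots,\lambda_\ell$ in this order; $\lambda_1$ gets mark $1$. For $p>1$: (a) a non-overlined odd $\lambda_p$ gets mark $1$; (b) an overlined even $\lambda_p$ gets mark $1$; (c) an overlined odd $\lambda_p$ gets the least positive integer not used as the mark of any $\lambda_j$ ($j<p$) with $|\lambda_p|-|\lambda_j|=1$; (d) if $\lambda_p=2t+2$ is non-overlined even, let $f$ be the least positive integer not used as the mark of any $\lambda_j$ ($j<p$) with $|\lambda_p|-|\lambda_j|\le2$, and $g$ the least positive integer used as the mark of some $\lambda_j$ ($j<p$) with $|\lambda_p|-|\lambda_j|=2$ ($g=0$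 if none); if simultaneously (i) $g\ge2$, (ii) the mark of $\lambda_{p-1}$ is $g-1$, (iii) a non-overlined $2t+1$ or an $\overline{2t+2}$ occurs in $\lambda$, (iv) $\overline{2t+1}$ does not occur in $\lambda$, then $\lambda_p$ gets mark $g$, otherwise mark $f$. A part with mark $r$ is $r$-marked. $\mathbb{O}_{k,i}(m,n)$: overpartitions of $n$ with exactly $m$ parts such that (1) $f_{\overline1}+f_2\le i-1$; (2) $f_{\overline{2t}}+f_{2t}+f_{\overline{2t+1}}+f_{2t+2}\le k-1$ for all $t\ge0$; (3) for all $t\ge0$, $f_{2t+1}\ge1$ implies $f_{2t+2}\le k-2$. $\mathbb{F}_{k,i}(m,n)$: those $\lambda\in\mathbb{O}_{k,i}(m,n)$ whose smallest part is an overlined odd part or a non-overlined even part. $\mathbb{F}_{N_1,\dots,N_{k-1};i}$: the set of $\lambda\in\bigcup_{n\ge0}\mathbb{F}_{k,i}(N_1+\cdots+N_{k-1},n)$ having exactly $N_r$ $r$-marked parts for each $1\le r\le k-1$. $\mathbb{G}_{N_1,\dots,N_{k-1};i}$: those $\lambda\in\mathbb{F}_{N_1,\dots,N_{k-1};i}$ with no overlined even parts and no non-overlined odd parts. For $N\ge0$, $\mathbb{R}_N$ is the set of finite sets (partitions) $\tau=(\tau_1<\cdots<\tau_\ell)$ of distinct negative even integers in $[-2N,-2]$, with $|\tau|=\tau_1+\cdots+\tau_\ell$ (so $\sum_{\tau\in\mathbb{R}_N}q^{|\tau|}=(-q^{-2N};q^2)_N$). *)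

theory Defs
  imports Main
begin

datatype part = Overlined (psize: nat) | Plain (psize: nat)

fun overlined :: "part \<Rightarrow> bool" where
  "overlined (Overlined t) \<longleftrightarrow> True"
| "overlined (Plain t) \<longleftrightarrow> False"

instantiation part :: linorder
begin

definition less_eq_part :: "part \<Rightarrow> part \<Rightarrow> bool" where
  "a \<le> b \<longleftrightarrow> psize a < psize b \<or> psize a = psize b \<and> (overlined b \<longrightarrow> overlined a)"

definition less_part :: "part \<Rightarrow> part \<Rightarrow> bool" where
  "a < b \<longleftrightarrow> psize a < psize b \<or> psize a = psize b \<and> overlined a \<and> \<not> overlined b"

instance
proof
  fix x y z :: part
  show "x < y \<longleftrightarrow> x \<le> y \<and> \<not> y \<le> x"
    by (auto simp: less_eq_part_def less_part_def)
  show "x \<le> x"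
    by (simp add: less_eq_part_def)
  show "x \<le> y \<Longrightarrow> y \<le> z \<Longrightarrow> x \<le> z"
    by (auto simp: less_eq_part_def)
  show "x \<le> y \<Longrightarrow> y \<le> x \<Longrightarrow> x = y"
    by (cases x; cases y) (auto simp: less_eq_part_def)
  show "x \<le> y \<or> y \<le> x"
    by (auto simp: less_eq_part_def)
qed

end

definition overpartition :: "part list \<Rightarrow> bool" where
  "overpartition l \<longleftrightarrow>
     sorted l \<and> (\<forall>x\<in>set l. 0 < psize x) \<and> (\<forall>t. count_list l (Overlined t) \<le> 1)"

definition weight :: "part list \<Rightarrow> nat" where
  "weight l = sum_list (map psize l)"

definition mex1 :: "nat set \<Rightarrow> nat" where
  "mex1 A = (LEAST r. 0 < r \<and> r \<notin> A)"

text \<open>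
  The mark of the part at (0-based) position \<open>length ms\<close> of \<open>l\<close>, where \<open>ms\<close> lists the marks of the
  preceding parts. Conditions (iii) and (iv) of the marking refer to all of \<open>l\<close>.
  The part sizes are nondecreasing, so \<open>|l_p| - |l_j| \<le> 2\<close> can be written \<open>s \<le> |l_j| + 2\<close>.
\<close>

definition next_mark :: "part list \<Rightarrow> nat list \<Rightarrow> nat" where
  "next_mark l ms =
     (let p = length ms in
      if p = 0 then 1
      else case l ! p of
        Overlined s \<Rightarrow>
          if even s then 1
          else mex1 {ms ! j | j. j < p \<and> s = psize (l ! j) + 1}
      | Plain s \<Rightarrow>
          if odd s then 1
          else
            let f = mex1 {ms ! j | j. j < p \<and> s \<le> psize (l ! j) + 2};
                U = {ms ! j | j. j < p \<and> s = psize (l ! j) + 2};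
                g = (if U = {} then 0 else LEAST r. 0 < r \<and> r \<in> U)
            in if 2 \<le> g \<and> ms ! (p - 1) = g - 1
                  \<and> (Plain (s - 1) \<in> set l \<or> Overlined s \<in> set l)
                  \<and> Overlined (s - 1) \<notin> set l
               then g else f)"

primrec marks_upto :: "part list \<Rightarrow> nat \<Rightarrow> nat list" where
  "marks_upto l 0 = []"
| "marks_upto l (Suc p) = marks_upto l p @ [next_mark l (marks_upto l p)]"

definition GG_marking :: "part list \<Rightarrow> nat list" where
  "GG_marking l = marks_upto l (length l)"

text \<open>
  The upper bounds \<open>i - 1\<close>, \<open>k - 1\<close> and \<open>k - 2\<close> are moved to the left-hand side, so that they are
  not affected by truncated subtraction (for \<open>k = 1\<close> the bound \<open>k - 2\<close> is negative).
\<close>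

definition O_set :: "nat \<Rightarrow> nat \<Rightarrow> nat \<Rightarrow> nat \<Rightarrow> part list set" where
  "O_set k i m n =
     {l. overpartition l \<and> length l = m \<and> weight l = n
       \<and> count_list l (Overlined 1) + count_list l (Plain 2) + 1 \<le> i
       \<and> (\<forall>t. count_list l (Overlined (2*t)) + count_list l (Plain (2*t))
              + count_list l (Overlined (2*t + 1)) + count_list l (Plain (2*t + 2)) + 1 \<le> k)
       \<and> (\<forall>t. 1 \<le> count_list l (Plain (2*t + 1)) \<longrightarrow> count_list l (Plain (2*t + 2)) + 2 \<le> k)}"

text \<open>An overlined odd or a non-overlined even part.\<close>

definition F_part :: "part \<Rightarrow> bool" where
  "F_part x \<longleftrightarrow> (if overlined x then odd (psize x) else even (psize x))"

text \<open>The condition on the smallest part is vacuous for the empty overpartition.\<close>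

definition F_set :: "nat \<Rightarrow> nat \<Rightarrow> nat \<Rightarrow> nat \<Rightarrow> part list set" where
  "F_set k i m n = {l \<in> O_set k i m n. l \<noteq> [] \<longrightarrow> F_part (hd l)}"

text \<open>The numbers \<open>N_1, ..., N_{k-1}\<close> are the values \<open>N 1, ..., N (k - 1)\<close> of a function;
  the other values of \<open>N\<close> are irrelevant here.\<close>

definition F_marked :: "nat \<Rightarrow> (nat \<Rightarrow> nat) \<Rightarrow> nat \<Rightarrow> part list set" where
  "F_marked k N i =
     {l \<in> (\<Union>n. F_set k i (\<Sum>r = 1..k - 1. N r) n).
        \<forall>r\<in>{1..k - 1}. count_list (GG_marking l) r = N r}"

definition G_marked :: "nat \<Rightarrow> (nat \<Rightarrow> nat) \<Rightarrow> nat \<Rightarrow> part list set" where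
  "G_marked k N i =
     {l \<in> F_marked k N i. \<forall>x\<in>set l. \<not> (overlined x \<and> even (psize x))
                                    \<and> \<not> (\<not> overlined x \<and> odd (psize x))}"

text \<open>
  The argument is an integer because it occurs as \<open>N_1 - 1\<close>; for \<open>N_1 = 0\<close> the interval is empty
  and \<open>R_set (-1) = {{}}\<close>.
\<close>

definition R_set :: "int \<Rightarrow> int set set" where
  "R_set M = {T. finite T \<and> (\<forall>x\<in>T. even x \<and> - 2 * M \<le> x \<and> x \<le> - 2)}"

end

theory Submission
  imports Defs "HOL-Library.Multiset"
begin

text \<open>
  Call overlined odd and plain even parts regular. Let \<open>K\<^sub>r\<close> be the number of parts with mark at most
  \<open>r\<close>. It is computed by a greedy selection from small to large parts, in which the exceptional rule
  (d) disappears, and conditions (2) and (3) follow from \<open>K\<^sub>k\<^sub>-\<^sub>1\<close> being the number of all parts.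

  Take the last irregular part and the 1-marked parts after it, \<open>j\<close> parts in total. Adding 2 to the
  size of each of them, where the irregular part becomes regular, preserves all \<open>K\<^sub>r\<close>. The step is
  undone by the mirror-image greedy selection of \<open>j\<close> parts from the right, and after it the chain that
  starts at the new last irregular part has more than \<open>j\<close> elements. So iterating the step removes all
  irregular parts with strictly increasing \<open>j\<close>, and the numbers \<open>-2j\<close> form \<open>\<tau>\<close>. Here \<open>j < N\<^sub>1\<close>
  because the smallest part is regular and 1-marked.
\<close>

section \<open>Marks and greedy selection\<close>

text \<open>Individual marks are hard to follow through a step, so only the counts
  \<open>K\<^sub>r\<close> are tracked; the \<open>N\<^sub>r\<close> are their differences. For
  fixed \<open>r\<close>, all that the marks of smaller sizes pass on to the sizes 2u+1 and 2u+2 is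
  one number: how many marks up to \<open>r\<close> occur at size 2u. Rule (d) is the obstacle. This
  exception is the origin of the maximum in the selection. For the bijection, let B(j) contain the
  overpartitions with index above j, where the index is the number of parts the next step moves, or
  the number of 1-marked parts if there is nothing to move. Step j maps B(j-1) - B(j) onto B(j), so
  B(j-1) is two copies of B(j), matching the choice whether -2j belongs to \<tau>. Both the growth
  of j and the existence of the inverse come from one fact: a greedy chain is at least as long as
  any other sufficiently spaced set of selectable sizes.\<close>

lemma mex1_ex: assumes "finite A" shows "\<exists>r::nat. 0 < r \<and> r \<notin> A"
proof -
  have "infinite {r::nat. 0 < r}" by (metis infinite_Ioi greaterThan_def)
  then obtain r where "r \<in> {r::nat. 0 < r}" "r \<notin> A" using assms by (meson finite_subset subsetI)
  then show ?thesis by blast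
qed

lemma mex1_pos_notin: assumes "finite A" shows "0 < mex1 A" "mex1 A \<notin> A"
  using LeastI_ex[OF mex1_ex[OF assms]] unfolding mex1_def by auto

lemma mex1_below: "0 < r \<Longrightarrow> r < mex1 A \<Longrightarrow> r \<in> A"
  unfolding mex1_def using not_less_Least by blast

lemma mex1_eqI: "0 < m \<Longrightarrow> m \<notin> A \<Longrightarrow> (\<And>r. 0 < r \<Longrightarrow> r < m \<Longrightarrow> r \<in> A) \<Longrightarrow> mex1 A = m"
  unfolding mex1_def by (rule Least_equality) (auto intro: leI)

text \<open>Failure of \<open>mex1 A \<le> r\<close> means that all of 1, ..., r lie in
  \<open>A\<close>. This turns marks into counts: later arguments only need to know how many blocked
  marks are at most \<open>r\<close>.\<close>

lemma mex1_le_iff: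
  assumes "finite A"
  shows "mex1 A \<le> r \<longleftrightarrow> card {a\<in>A. 0 < a \<and> a \<le> r} < r"
proof
  assume le: "mex1 A \<le> r"
  note mex = mex1_pos_notin[OF assms]
  have "{a\<in>A. 0 < a \<and> a \<le> r} \<subseteq> {0<..r} - {mex1 A}" using mex(2) by auto
  then have "card {a\<in>A. 0 < a \<and> a \<le> r} \<le> card ({0<..r} - {mex1 A})" by (intro card_mono) auto
  also have "\<dots> < r" using mex(1) le by simp
  finally show "card {a\<in>A. 0 < a \<and> a \<le> r} < r" .
next
  assume lt: "card {a\<in>A. 0 < a \<and> a \<le> r} < r"
  show "mex1 A \<le> r"
  proof (rule ccontr)
    assume "\<not> mex1 A \<le> r"
    then have "{0<..r} \<subseteq> {a\<in>A. 0 < a \<and> a \<le> r}" using mex1_below[of _ A] by auto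
    from card_mono[OF _ this] show False using lt assms by simp
  qed
qed

text \<open>A run of equal parts takes the first \<open>b\<close> positive integers outside
  \<open>W\<close> in increasing order, so the number of its marks up to \<open>r\<close> depends
  only on \<open>b\<close> and on how many elements of \<open>W\<close> lie up to
  \<open>r\<close>.\<close>

lemma mex1_sequence:
  fixes m :: "nat \<Rightarrow> nat"
  assumes fin: "finite W" and m: "\<And>q. q < b \<Longrightarrow> m q = mex1 (W \<union> m ` {..<q})"
  shows "inj_on m {..<b} \<and> m ` {..<b} \<inter> W = {} \<and> 0 \<notin> m ` {..<b} \<and>
    (\<forall>r. card {i. i < b \<and> m i \<le> r} = min b (r - card {w\<in>W. 0 < w \<and> w \<le> r}))"
  using m
proof (induction b)
  case 0
  then show ?case by simp
next
  case (Suc b)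
  then have IH: "inj_on m {..<b}" "m ` {..<b} \<inter> W = {}" "0 \<notin> m ` {..<b}"
    "\<And>r. card {i. i < b \<and> m i \<le> r} = min b (r - card {w\<in>W. 0 < w \<and> w \<le> r})"
    by auto
  have mb: "m b = mex1 (W \<union> m ` {..<b})" using Suc.prems by simp
  have finU: "finite (W \<union> m ` {..<b})" using fin by simp
  note p = mex1_pos_notin[OF finU, folded mb]
  have c: "card {i. i < Suc b \<and> m i \<le> r} = min (Suc b) (r - card {w\<in>W. 0 < w \<and> w \<le> r})" for r
  proof -
    have "{a \<in> W \<union> m ` {..<b}. 0 < a \<and> a \<le> r} =
        {w\<in>W. 0 < w \<and> w \<le> r} \<union> m ` {i. i < b \<and> m i \<le> r}"
      using IH(3) by (fastforce intro: gr0I)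
    moreover have "card (m ` {i. i < b \<and> m i \<le> r}) = card {i. i < b \<and> m i \<le> r}"
      by (rule card_image, rule inj_on_subset[OF IH(1)]) auto
    moreover have "{w\<in>W. 0 < w \<and> w \<le> r} \<inter> m ` {i. i < b \<and> m i \<le> r} = {}" using IH(2) by auto
    ultimately have cu: "card {a \<in> W \<union> m ` {..<b}. 0 < a \<and> a \<le> r} =
        card {w\<in>W. 0 < w \<and> w \<le> r} + min b (r - card {w\<in>W. 0 < w \<and> w \<le> r})"
      using fin by (simp add: card_Un_disjoint IH(4))
    have "card {w\<in>W. 0 < w \<and> w \<le> r} \<le> card {0<..r}" by (rule card_mono) auto
    then have cr: "card {w\<in>W. 0 < w \<and> w \<le> r} \<le> r" by simp
    have lt: "m b \<le> r \<longleftrightarrow> b < r - card {w\<in>W. 0 < w \<and> w \<le> r}"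
      unfolding mb mex1_le_iff[OF finU] cu using cr by linarith
    have "{i. i < Suc b \<and> m i \<le> r} = (if m b \<le> r then insert b {i. i < b \<and> m i \<le> r} else {i. i < b \<and> m i \<le> r})"
      by (auto simp: less_Suc_eq)
    then have "card {i. i < Suc b \<and> m i \<le> r} = (if m b \<le> r then 1 else 0) + card {i. i < b \<and> m i \<le> r}"
      by simp
    then show ?thesis using lt IH(4)[of r] by auto
  qed
  have "inj_on m {..<Suc b}" using IH(1) p(2) by (simp add: lessThan_Suc)
  moreover have "m ` {..<Suc b} \<inter> W = {}" using IH(2) p(2) by (simp add: lessThan_Suc)
  moreover have "0 \<notin> m ` {..<Suc b}" using IH(3) p(1) by (simp add: lessThan_Suc)
  ultimately show ?case using c by blast
qed

lemma image_add2: "(\<lambda>i. i + 2) ` {..<q::nat} = {2..<q+2}"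
  using image_add_atLeastLessThan'[of 2 0 q] by (simp add: lessThan_atLeast0 numeral_2_eq_2)

text \<open>Rule (d) amounts to releasing the mark \<open>g\<close> for reuse.\<close>

lemma special_sequence:
  fixes m :: "nat \<Rightarrow> nat"
  assumes fin: "finite S" and pos: "0 \<notin> S" and S: "S \<noteq> {}" "1 \<notin> S"
    and m: "\<And>q. q < b \<Longrightarrow> m q = (if (if q = 0 then 1 else m (q - 1)) = Min S - 1 then Min S
               else mex1 (insert 1 S \<union> m ` {..<q}))"
    and q: "q < b"
  shows "m q = mex1 ((insert 1 S - {Min S}) \<union> m ` {..<q})"
  using q
proof (induction q rule: less_induct)
  case (less q)
  let ?g = "Min S" and ?W = "insert 1 S - {Min S}"
  have gS: "?g \<in> S" using fin S by simp
  have g2: "2 \<le> ?g" proof -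
    have "?g \<noteq> 0" "?g \<noteq> 1" using gS pos S by metis+
    then show ?thesis by linarith
  qed
  have gmin: "x < ?g \<Longrightarrow> x \<notin> S" for x using fin by (meson Min_le not_less)
  have gle: "x \<in> S \<Longrightarrow> ?g \<le> x" for x using fin by simp
  have IH: "m q' = mex1 (?W \<union> m ` {..<q'})" if "q' < q" for q'
    using less.IH[OF that] that less.prems by linarith
  \<comment> \<open>Apart from 1 nothing below \<open>?g\<close> is blocked, so the run takes 2, 3,
    ... without a gap until it reaches \<open>?g\<close>.\<close>
  have small: "m q' = q' + 2" if "q' < q" "q' + 2 \<le> ?g" for q'
  proof -
    have "n < q \<longrightarrow> n + 2 \<le> ?g \<longrightarrow> m n = n + 2" for n
    proof (induction n rule: less_induct)
      case (less n)
      show ?case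
      proof (intro impI)
        assume n: "n < q" "n + 2 \<le> ?g"
        have "m i = i + 2" if "i < n" for i
          using less.IH[rule_format, OF that] that n by linarith
        then have "m ` {..<n} = (\<lambda>i. i + 2) ` {..<n}"
          by (intro image_cong[OF refl]) (simp only: lessThan_iff)
        also have "\<dots> = {2..<n+2}" by (rule image_add2)
        finally have eq: "m ` {..<n} = {2..<n+2}" .
        show "m n = n + 2" unfolding IH[OF n(1)] eq
          using n(2) by (intro mex1_eqI) (auto dest: gle)
      qed
    qed
    then show ?thesis using that by blast
  qed
  \<comment> \<open>Once \<open>?g\<close> has been given, all of 1, ..., \<open>?g\<close> are in
    use. Later marks exceed \<open>?g\<close>, and the exceptional condition cannot hold
    again.\<close>
  have big: "?g < m q'" if "q' < q" "?g < q' + 2" for q'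
  proof -
    have "?g - 2 < q'" using that g2 by simp
    then have "?g = m (?g - 2)" using small[of "?g - 2"] that g2 by simp
    then have "?g \<in> m ` {..<q'}" using \<open>?g - 2 < q'\<close> by blast
    have "{1..?g} \<subseteq> ?W \<union> m ` {..<q'}"
    proof
      fix x assume x: "x \<in> {1..?g}"
      show "x \<in> ?W \<union> m ` {..<q'}"
      proof (cases "x = 1")
        case True then show ?thesis using g2 by auto
      next
        case False
        then have y: "x = x - 2 + 2" "x \<le> ?g" using x by auto
        then have lt: "x - 2 < q'" using that by linarith
        have "m (x - 2) = x - 2 + 2" by (rule small) (use y lt that in linarith)+
        then have "x = m (x - 2)" using y by linarith
        moreover note lt
          ultimately show ?thesis by blast
      qed
    qed
    moreover have "m q' \<notin> ?W \<union> m ` {..<q'}" "0 < m q'"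
      using mex1_pos_notin[of "?W \<union> m ` {..<q'}"] IH[OF that(1)] fin by auto
    ultimately have "m q' \<notin> {1..?g}" by blast
    then show ?thesis using \<open>0 < m q'\<close> by auto
  qed
  have seg: "m ` {..<q} = {2..<q+2}" if "q + 2 \<le> ?g + 1"
  proof -
    have "m ` {..<q} = (\<lambda>i. i + 2) ` {..<q}"
      by (rule image_cong[OF refl], rule small) (use that in auto)
    also have "\<dots> = {2..<q+2}" by (rule image_add2)
    finally show ?thesis .
  qed
  consider "q + 2 = ?g" | "q + 2 < ?g" | "?g < q + 2" by linarith
  then show ?case
  proof cases
    case 1
    \<comment> \<open>For \<open>q = 0\<close> and \<open>?g = 2\<close> the value 1 stands for the
      mark of the part before the run.\<close>
    have "(if q = 0 then 1 else m (q - 1)) = ?g - 1" using 1 small[of "q - 1"] by auto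
    then have "m q = ?g" using m[OF less.prems] by simp
    moreover have "mex1 (?W \<union> m ` {..<q}) = ?g"
      using 1 g2 seg by (intro mex1_eqI) (auto dest: gle)
    ultimately show ?thesis by simp
  next
    case 2
    have "(if q = 0 then 1 else m (q - 1)) \<noteq> ?g - 1" using 2 small[of "q - 1"] by auto
    then have "m q = mex1 (insert 1 S \<union> m ` {..<q})" using m[OF less.prems] by simp
    also have "\<dots> = q + 2" using 2 seg by (intro mex1_eqI) (auto dest: gle)
    also have "q + 2 = mex1 (?W \<union> m ` {..<q})" using 2 seg by (intro mex1_eqI[symmetric]) (auto dest: gle)
    finally show ?thesis .
  next
    case 3
    then have q0: "q \<noteq> 0" "?g - 2 < q" using g2 by auto
    have gm: "m (?g - 2) = ?g" using small[of "?g - 2"] q0 g2 by simp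
    have "?g \<le> m (q - 1)"
    proof (cases "q - 1 = ?g - 2")
      case True
      then show ?thesis using gm by (metis order_refl)
    next
      case False
      then have "?g < m (q - 1)" using q0 3 by (intro big) linarith+
      then show ?thesis by linarith
    qed
    then have "m q = mex1 (insert 1 S \<union> m ` {..<q})" using m[OF less.prems] q0 g2 by auto
    \<comment> \<open>By now \<open>?g\<close> is among the earlier marks of the run, so it is
      blocked whether or not it was released.\<close>
    moreover have "insert 1 S \<union> m ` {..<q} = ?W \<union> m ` {..<q}"
      using gm q0(2) by (auto intro: rev_image_eqI)
    ultimately show ?thesis by simp
  qed
qed

text \<open>
  If \<open>f\<close> gives the multiplicities of an overpartition, then \<open>kept_even r f u\<close> is the number of parts of
  size \<open>2u\<close>, overlined or not, with mark at most \<open>r\<close>; \<open>kept_overlined r f u\<close> and \<open>kept_plain r f u\<close>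
  are the numbers of such overlined parts \<open>2u+1\<close> and plain parts \<open>2u+2\<close>.
\<close>

primrec kept_even :: "nat \<Rightarrow> (part \<Rightarrow> nat) \<Rightarrow> nat \<Rightarrow> nat" where
  "kept_even r f 0 = 0"
| "kept_even r f (Suc u) = f (Overlined (2*u+2)) + min (f (Plain (2*u+2)))
     (r - max (kept_even r f u + min (f (Overlined (2*u+1))) (r - kept_even r f u))
              (if 0 < f (Plain (2*u+1)) + f (Overlined (2*u+2)) then 1 else 0))"

definition kept_overlined :: "nat \<Rightarrow> (part \<Rightarrow> nat) \<Rightarrow> nat \<Rightarrow> nat" where
  "kept_overlined r f u = min (f (Overlined (2*u+1))) (r - kept_even r f u)"

definition kept_plain :: "nat \<Rightarrow> (part \<Rightarrow> nat) \<Rightarrow> nat \<Rightarrow> nat" where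
  "kept_plain r f u = min (f (Plain (2*u+2)))
     (r - max (kept_even r f u + kept_overlined r f u)
              (if 0 < f (Plain (2*u+1)) + f (Overlined (2*u+2)) then 1 else 0))"

lemma kept_even_Suc: "kept_even r f (Suc u) = f (Overlined (2*u+2)) + kept_plain r f u"
  by (simp add: kept_plain_def kept_overlined_def)

declare kept_even.simps(2) [simp del]

text \<open>Column \<open>u\<close> consists of the sizes 2u+1 and 2u+2. Its plain odd and overlined
  even parts always carry mark 1, so for \<open>r \<ge> 1\<close> they are counted in full.\<close>

definition kept :: "nat \<Rightarrow> (part \<Rightarrow> nat) \<Rightarrow> nat \<Rightarrow> nat" where
  "kept r f u = kept_overlined r f u + f (Plain (2*u+1)) + f (Overlined (2*u+2)) + kept_plain r f u"

definition mark :: "part list \<Rightarrow> nat \<Rightarrow> nat" where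
  "mark l p = next_mark l (marks_upto l p)"

lemma marks_upto_eq: "marks_upto l p = map (mark l) [0..<p]"
  by (induction p) (auto simp: mark_def)

text \<open>Trades the accumulator of \<open>next_mark\<close> for a recursion over positions, so
  that the windows of the marking rules become sets of indices.\<close>

lemma mark_unfold:
  "mark l p = (if p = 0 then 1 else case l ! p of
        Overlined s \<Rightarrow>
          if even s then 1
          else mex1 {mark l j | j. j < p \<and> s = psize (l ! j) + 1}
      | Plain s \<Rightarrow>
          if odd s then 1
          else
            let f = mex1 {mark l j | j. j < p \<and> s \<le> psize (l ! j) + 2};
                U = {mark l j | j. j < p \<and> s = psize (l ! j) + 2};
                g = (if U = {} then 0 else LEAST r. 0 < r \<and> r \<in> U)
            in if 2 \<le> g \<and> mark l (p - 1) = g - 1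
                  \<and> (Plain (s - 1) \<in> set l \<or> Overlined s \<in> set l)
                  \<and> Overlined (s - 1) \<notin> set l
               then g else f)"
proof (cases "p = 0")
  case True
  then show ?thesis by (simp add: mark_def next_mark_def)
next
  case False
  have e: "{map (mark l) [0..<p] ! j |j. j < p \<and> Q j} = {mark l j |j. j < p \<and> Q j}" for Q
    by (rule Collect_cong) (metis add_0 diff_zero length_upt nth_map nth_upt)
  have "map (mark l) [0..<p] ! (p - 1) = mark l (p - 1)" using False by simp
  then show ?thesis
    unfolding mark_def[of l p] next_mark_def marks_upto_eq using False
    by (simp only: length_map length_upt diff_zero e Let_def if_False)
qed

section \<open>Positions of equal parts in a sorted list\<close>

lemma sorted_split:
  fixes x :: part
  assumes "sorted l"
  shows "l = filter (\<lambda>y. y < x) l @ replicate (count_list l x) x @ filter (\<lambda>y. x < y) l"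
  using assms
proof (induction l)
  case (Cons a l)
  then have IH: "l = filter (\<lambda>y. y < x) l @ replicate (count_list l x) x @ filter (\<lambda>y. x < y) l"
    and ge: "\<forall>y\<in>set l. a \<le> y" by auto
  consider "a < x" | "a = x" | "x < a" by fastforce
  then show ?case
  proof cases
    case 1
    then have "a \<noteq> x" "\<not> x < a" by auto
    then show ?thesis using 1 IH by simp
  next
    case 2
    then have "filter (\<lambda>y. y < x) l = []" using ge by (auto simp: filter_empty_conv)
    then show ?thesis using 2 IH by simp
  next
    case 3
    then have "filter (\<lambda>y. y < x) l = []" "count_list l x = 0"
      using ge by (auto simp: filter_empty_conv count_list_0_iff)
    moreover have "a \<noteq> x" "\<not> a < x" using 3 by auto
    ultimately show ?thesis using 3 IH by simp
  qed
qed simp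

lemma index_split:
  fixes x :: "'a::linorder"
  assumes "\<forall>y\<in>set A. y < x" "\<forall>y\<in>set C. x < y" "j < length (A @ replicate n x @ C)"
  shows "((A @ replicate n x @ C) ! j < x \<longleftrightarrow> j < length A) \<and>
    ((A @ replicate n x @ C) ! j = x \<longleftrightarrow> length A \<le> j \<and> j < length A + n)"
proof -
  consider "j < length A" | "length A \<le> j" "j < length A + n" | "length A + n \<le> j" by linarith
  then show ?thesis
  proof cases
    case 1
    then have "A ! j < x" using assms(1) by simp
    then show ?thesis using 1 by (auto simp: nth_append)
  next
    case 2
    then have "(A @ replicate n x @ C) ! j = x" by (auto simp: nth_append)
    then show ?thesis using 2 by simp
  next
    case 3
    then have "x < C ! (j - length A - n)" using assms(2,3) by (auto simp: less_diff_conv2)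
    then have "x < (A @ replicate n x @ C) ! j" using 3 by (auto simp: nth_append)
    then show ?thesis using 3 by auto
  qed
qed

lemma sorted_index:
  fixes x :: part
  assumes "sorted l" "j < length l"
  defines "p \<equiv> length (filter (\<lambda>y. y < x) l)"
  shows "l ! j < x \<longleftrightarrow> j < p" "l ! j = x \<longleftrightarrow> p \<le> j \<and> j < p + count_list l x"
  using index_split[of "filter (\<lambda>y. y < x) l" x "filter (\<lambda>y. x < y) l" j "count_list l x"]
    assms(2) unfolding p_def sorted_split[OF assms(1), of x, symmetric] by auto

lemma sorted_index_bound:
  fixes x :: part
  assumes "sorted l"
  shows "length (filter (\<lambda>y. y < x) l) + count_list l x \<le> length l"
  by (subst (3) sorted_split[OF assms, of x]) simp

section \<open>Marks of the sizes 2u+1 and 2u+2, given those of size 2u\<close>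

definition marks_at :: "part list \<Rightarrow> part set \<Rightarrow> nat set" where
  "marks_at l X = mark l ` {j. j < length l \<and> l ! j \<in> X}"

lemma finite_marks_at [simp]: "finite (marks_at l X)"
  by (simp add: marks_at_def)

lemma marks_at_Un: "marks_at l (X \<union> Y) = marks_at l X \<union> marks_at l Y"
  by (auto simp: marks_at_def)

lemma marks_at_empty_iff: "marks_at l X = {} \<longleftrightarrow> set l \<inter> X = {}"
  by (auto simp: marks_at_def set_conv_nth)

lemma mark_trivial: "l ! p = Plain (2*u+1) \<or> l ! p = Overlined (2*u+2) \<Longrightarrow> mark l p = 1"
  by (subst mark_unfold) auto

lemma mex1_empty: "mex1 {} = 1"
  by (rule mex1_eqI) auto

text \<open>Parts smaller than \<open>l ! p\<close> all precede position \<open>p\<close>, so a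
  window that consists of smaller parts may be taken over the whole list.\<close>

lemma marks_before:
  fixes l :: "part list"
  assumes "sorted l" "p < length l" "\<And>x. x \<in> X \<Longrightarrow> x < l ! p"
  shows "{mark l j | j. j < p \<and> l ! j \<in> X} = marks_at l X"
proof -
  have "j < p" if "j < length l" "l ! j \<in> X" for j
    using assms(3)[OF that(2)] sorted_nth_mono[OF assms(1), of p j] that
    by (metis leD not_le_imp_less)
  then show ?thesis using assms(2) by (auto simp: marks_at_def)
qed

lemma mark_overlined:
  assumes "sorted l" "p < length l" "l ! p = Overlined (2*u+1)"
  shows "mark l p = mex1 (marks_at l {x. psize x = 2*u})"
proof -
  have "{mark l j | j. j < p \<and> 2*u+1 = psize (l ! j) + 1} = marks_at l {x. psize x = 2*u}"
    using marks_before[OF assms(1,2), of "{x. psize x = 2*u}"] assms(3)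
    by (simp add: less_part_def eq_commute[of "2*u"])
  then show ?thesis using assms(3)
    by (subst mark_unfold) (auto simp: mex1_empty)
qed

text \<open>The equal parts \<open>x\<close> occupy consecutive positions from \<open>p0\<close> on,
  so the window of rule (d) is \<open>W\<close> together with the part of the run already marked.
  Writing 1 for the mark of the predecessor at \<open>q = 0\<close> is harmless, because this mark
  matters only when condition (iii) holds.\<close>

lemma mark_plain:
  fixes u :: nat
  assumes l: "sorted l" and S0: "0 \<notin> S"
  defines "x \<equiv> Plain (2*u+2)"
  defines "p0 \<equiv> length (filter (\<lambda>y. y < x) l)"
  defines "m \<equiv> \<lambda>q. mark l (p0 + q)"
  defines "W \<equiv> {x. psize x = 2*u \<or> psize x = 2*u+1 \<or> x = Overlined (2*u+2)}"
  assumes S: "S = marks_at l {x. psize x = 2*u}"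
    and q: "q < count_list l x"
  shows "m q = (if S \<noteq> {} \<and> 2 \<le> Min S \<and> (if q = 0 then 1 else m (q - 1)) = Min S - 1
        \<and> (Plain (2*u+1) \<in> set l \<or> Overlined (2*u+2) \<in> set l) \<and> Overlined (2*u+1) \<notin> set l
      then Min S else mex1 (marks_at l W \<union> m ` {..<q}))"
proof -
  define p where "p = p0 + q"
  have p: "p < length l" using q sorted_index_bound[OF l, of x] by (simp add: p_def p0_def)
  have lp: "l ! p = x" using sorted_index(2)[OF l p, of x] q by (simp add: p_def p0_def)
  have "{mark l j | j. j < p \<and> l ! j \<in> {x. psize x = 2*u}} = marks_at l {x. psize x = 2*u}"
    by (rule marks_before[OF l p]) (auto simp: lp x_def less_part_def)
  then have U: "{mark l j | j. j < p \<and> 2*u+2 = psize (l ! j) + 2} = S"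
    using S by (simp add: eq_commute[of "2*u"])
  have Wx: "y < x" if "y \<in> W" for y using that by (auto simp: W_def x_def less_part_def)
  have W': "{mark l j | j. j < p \<and> l ! j \<in> W} = marks_at l W"
    by (rule marks_before[OF l p]) (use Wx lp in auto)
  have step: "(j < p \<and> 2*u+2 \<le> psize (l ! j) + 2) \<longleftrightarrow> (j < p \<and> l ! j \<in> W) \<or> (p0 \<le> j \<and> j < p0 + q)" for j
  proof (cases "j < p")
    case True
    then have j: "j < length l" using p by simp
    note si = sorted_index[OF l j, of x, folded p0_def]
    show ?thesis
    proof (cases "j < p0")
      case True
      then have "l ! j < x" using si by simp
      then have "2*u+2 \<le> psize (l ! j) + 2 \<longleftrightarrow> l ! j \<in> W"
        by (cases "l ! j") (auto simp: x_def W_def less_part_def)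
      then show ?thesis using True by (auto simp: p_def)
    next
      case False
      then have "l ! j = x" using si \<open>j < p\<close> q by (simp add: p_def)
      then show ?thesis using False \<open>j < p\<close> by (auto simp: p_def x_def)
    qed
  qed (auto simp: p_def)
  have "{mark l j | j. j < p \<and> 2*u+2 \<le> psize (l ! j) + 2}
      = {mark l j | j. j < p \<and> l ! j \<in> W} \<union> {mark l j | j. p0 \<le> j \<and> j < p0 + q}"
    unfolding step by blast
  also have "{mark l j | j. p0 \<le> j \<and> j < p0 + q} = m ` {..<q}"
  proof (intro equalityI subsetI)
    fix y assume "y \<in> {mark l j | j. p0 \<le> j \<and> j < p0 + q}"
    then obtain j where "y = mark l j" "p0 \<le> j" "j < p0 + q" by blast
    then have "y = m (j - p0)" "j - p0 < q" by (auto simp: m_def)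
    then show "y \<in> m ` {..<q}" by blast
  qed (auto simp: m_def)
  finally have F: "{mark l j | j. j < p \<and> 2*u+2 \<le> psize (l ! j) + 2} = marks_at l W \<union> m ` {..<q}"
    using W' by simp
  have least: "(LEAST r. 0 < r \<and> r \<in> S) = Min S" if "S \<noteq> {}"
    by (rule Least_equality) (use that S S0 in \<open>auto intro!: gr0I\<close>)
  show ?thesis
  proof (cases "p = 0")
    case True
    then have e: "marks_at l W \<union> m ` {..<q} = {}" "S = {}"
      using F U by auto
    have "mark l p = 1" using True by (subst mark_unfold) simp
    then have "m q = 1" by (simp add: m_def p_def)
    then show ?thesis unfolding e by (simp add: mex1_empty)
  next
    case False
    \<comment> \<open>Under condition (iii) the part before the run is a plain 2u+1 or an overlined
      2u+2, since nothing else fits between such a part and \<open>x\<close> in the order.\<close>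
    have prev: "mark l (p - 1) = (if q = 0 then 1 else m (q - 1))"
      if oe: "Plain (2*u+1) \<in> set l \<or> Overlined (2*u+2) \<in> set l"
    proof (cases "q = 0")
      case True
      obtain y where y: "y \<in> set l" "y = Plain (2*u+1) \<or> y = Overlined (2*u+2)" using oe by blast
      then obtain j where j: "j < length l" "l ! j = y" by (auto simp: set_conv_nth)
      have "y < x" using y by (auto simp: x_def less_part_def)
      then have "j < p0" using sorted_index(1)[OF l j(1), of x] j p0_def by simp
      then have "y \<le> l ! (p - 1)" using sorted_nth_mono[OF l, of j "p - 1"] j p True p_def by simp
      moreover have "l ! (p - 1) < x"
        using sorted_index(1)[OF l, of "p - 1" x] p False True by (simp add: p_def p0_def)
      ultimately have "l ! (p - 1) = Plain (2*u+1) \<or> l ! (p - 1) = Overlined (2*u+2)"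
        using y by (cases "l ! (p - 1)") (auto simp: x_def less_part_def less_eq_part_def)
      then show ?thesis using True mark_trivial by auto
    qed (simp add: m_def p_def)
    let ?g = "if S = {} then 0 else LEAST r. 0 < r \<and> r \<in> S"
    have "even (2*u+2)" "2*u+2-1 = 2*u+1" by simp_all
    then have "m q = (if 2 \<le> ?g \<and> mark l (p - 1) = ?g - 1
        \<and> (Plain (2*u+1) \<in> set l \<or> Overlined (2*u+2) \<in> set l) \<and> Overlined (2*u+1) \<notin> set l
        then ?g else mex1 (marks_at l W \<union> m ` {..<q}))"
      unfolding m_def p_def[symmetric] mark_unfold[of l p] lp[unfolded x_def] part.case U
        F[unfolded m_def] Let_def using False by (simp only: if_False not_True_eq_False)
    then show ?thesis using least prev by (cases "S = {}") auto
  qed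
qed

lemma card_index: "card {j. j < length l \<and> l ! j = x} = count_list l x"
proof -
  have "count_list l x = length (filter (\<lambda>y. y = x) l)" by (induction l) auto
  then show ?thesis by (simp add: length_filter_conv_card)
qed

lemma marked_trivial:
  assumes "x = Plain (2*u+1) \<or> x = Overlined (2*u+2)" "1 \<le> r"
  shows "card {j. j < length l \<and> l ! j = x \<and> mark l j \<le> r} = count_list l x"
proof -
  have "{j. j < length l \<and> l ! j = x \<and> mark l j \<le> r} = {j. j < length l \<and> l ! j = x}"
    using assms mark_trivial[of l _ u] by auto
  then show ?thesis by (simp add: card_index)
qed

lemma overlined_position:
  assumes "overpartition l"
  obtains "count_list l (Overlined t) = 0" "{j. j < length l \<and> l ! j = Overlined t} = {}"
  | p where "count_list l (Overlined t) = 1" "{j. j < length l \<and> l ! j = Overlined t} = {p}"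
proof -
  have "count_list l (Overlined t) \<le> 1" using assms by (simp add: overpartition_def)
  then consider "count_list l (Overlined t) = 0" | "count_list l (Overlined t) = 1" by linarith
  then show ?thesis
  proof cases
    case 1
    moreover have "finite {j. j < length l \<and> l ! j = Overlined t}" by simp
    ultimately show ?thesis using card_index[of l "Overlined t"] that(1) by simp
  next
    case 2
    then show ?thesis using card_index[of l "Overlined t"] that(2) by (metis card_1_singletonE)
  qed
qed

text \<open>An overlined part of size 2u+1, if there is one, takes the mark \<open>mex1 S\<close>,
  which is at most \<open>r\<close> exactly if fewer than \<open>r\<close> elements of
  \<open>S\<close> are. The last claim recounts this through the set \<open>A\<close> of marks, the
  form needed for the run that follows.\<close>

lemma column_overlined:
  fixes l u
  assumes l: "overpartition l"
  defines "S \<equiv> marks_at l {x. psize x = 2*u}" and "f \<equiv> count_list l"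
    and "A \<equiv> marks_at l {Overlined (2*u+1)}"
  assumes S0: "0 \<notin> S" and cS: "\<And>r. 1 \<le> r \<Longrightarrow> card {m\<in>S. m \<le> r} = kept_even r f u"
  shows "1 \<le> r \<Longrightarrow> card {j. j < length l \<and> l ! j = Overlined (2*u+1) \<and> mark l j \<le> r} = kept_overlined r f u"
    and "A = (if f (Overlined (2*u+1)) = 0 then {} else {mex1 S})"
    and "1 \<le> r \<Longrightarrow> card {m\<in>A. m \<le> r} = kept_overlined r f u"
proof -
  have so: "sorted l" using l by (simp add: overpartition_def)
  have finS: "finite S" by (simp add: S_def)
  have lt: "mex1 S \<le> r \<longleftrightarrow> kept_even r f u < r" if "1 \<le> r" for r
  proof -
    have "{m\<in>S. 0 < m \<and> m \<le> r} = {m\<in>S. m \<le> r}" using S0 by (auto intro!: gr0I)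
    then show ?thesis using mex1_le_iff[OF finS, of r] cS[OF that] by simp
  qed
  have "(1 \<le> r \<longrightarrow> card {j. j < length l \<and> l ! j = Overlined (2*u+1) \<and> mark l j \<le> r} = kept_overlined r f u)
    \<and> A = (if f (Overlined (2*u+1)) = 0 then {} else {mex1 S})" for r
  proof (rule overlined_position[OF l, of "2*u+1"])
    assume c: "count_list l (Overlined (2*u+1)) = 0"
      and e: "{j. j < length l \<and> l ! j = Overlined (2*u+1)} = {}"
    then have "{j. j < length l \<and> l ! j = Overlined (2*u+1) \<and> mark l j \<le> r} = {}" by blast
    moreover have "A = {}" using e by (auto simp: A_def marks_at_def)
    ultimately show ?thesis using c by (simp add: f_def kept_overlined_def)
  next
    fix p
    assume c: "count_list l (Overlined (2*u+1)) = 1"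
      and e: "{j. j < length l \<and> l ! j = Overlined (2*u+1)} = {p}"
    then have "p < length l" "l ! p = Overlined (2*u+1)" by blast+
    then have mp: "mark l p = mex1 S" using mark_overlined[OF so] by (simp add: S_def)
    have "{j. j < length l \<and> l ! j = Overlined (2*u+1) \<and> mark l j \<le> r}
        = {j. j < length l \<and> l ! j = Overlined (2*u+1)} \<inter> {j. mark l j \<le> r}" by blast
    also have "\<dots> = (if mex1 S \<le> r then {p} else {})" unfolding e using mp by auto
    finally have "card {j. j < length l \<and> l ! j = Overlined (2*u+1) \<and> mark l j \<le> r} = (if mex1 S \<le> r then 1 else 0)"
      by simp
    moreover have "A = {mex1 S}" unfolding A_def marks_at_def singleton_iff e using mp by simp
    ultimately show ?thesis using c lt[of r] by (auto simp: f_def kept_overlined_def)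
  qed
  then show 1: "1 \<le> r \<Longrightarrow> card {j. j < length l \<and> l ! j = Overlined (2*u+1) \<and> mark l j \<le> r} = kept_overlined r f u"
    and 2: "A = (if f (Overlined (2*u+1)) = 0 then {} else {mex1 S})" by blast+
  show "1 \<le> r \<Longrightarrow> card {m\<in>A. m \<le> r} = kept_overlined r f u"
  proof -
    assume r: "1 \<le> r"
    have "f (Overlined (2*u+1)) \<le> 1" using l by (simp add: overpartition_def f_def)
    then consider "f (Overlined (2*u+1)) = 0" | "f (Overlined (2*u+1)) = 1" by linarith
    then show ?thesis
    proof cases
      case 1
      then show ?thesis using 2 by (simp add: kept_overlined_def)
    next
      case c: 2
      then have "{m\<in>A. m \<le> r} = (if mex1 S \<le> r then {mex1 S} else {})" using 2 by auto
      then show ?thesis using lt[OF r] c by (simp add: kept_overlined_def)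
    qed
  qed
qed

text \<open>The maximum in \<open>kept_plain\<close> comes from this set \<open>W\<close> of blocked
  marks. If a part with forced mark 1 is present (\<open>oe\<close>), no overlined 2u+1 occurs and
  \<open>S\<close> is nonempty without 1, then rule (d) exchanges \<open>Min S\<close> for 1, which
  raises the count up to \<open>r\<close> only if it was 0. Otherwise rule (d) never applies, and a
  forced mark 1, if present, is either blocked already or the only blocked mark.\<close>

lemma column_plain:
  fixes l u
  assumes l: "overpartition l"
  defines "S \<equiv> marks_at l {x. psize x = 2*u}" and "f \<equiv> count_list l"
  defines "p \<equiv> length (filter (\<lambda>y. y < Plain (2*u+2)) l)"
  defines "oe \<equiv> 0 < f (Plain (2*u+1)) + f (Overlined (2*u+2))"
  assumes S0: "0 \<notin> S" and cS: "\<And>r. 1 \<le> r \<Longrightarrow> card {m\<in>S. m \<le> r} = kept_even r f u"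
  obtains W where "finite W" "0 \<notin> W" "oe \<Longrightarrow> 1 \<in> W"
    "\<And>q. q < f (Plain (2*u+2)) \<Longrightarrow> mark l (p + q) = mex1 (W \<union> (\<lambda>q. mark l (p + q)) ` {..<q})"
    "\<And>r. 1 \<le> r \<Longrightarrow> card {w\<in>W. w \<le> r} = max (kept_even r f u + kept_overlined r f u) (if oe then 1 else 0)"
proof -
  define A where "A = marks_at l {Overlined (2*u+1)}"
  have A: "A = (if f (Overlined (2*u+1)) = 0 then {} else {mex1 S})"
    unfolding A_def f_def S_def
    by (rule column_overlined(2)[OF l]) (use S0 cS in \<open>simp_all add: S_def f_def\<close>)
  have cA: "card {m\<in>A. m \<le> r} = kept_overlined r f u" if "1 \<le> r" for r
    unfolding A_def f_def
    by (rule column_overlined(3)[OF l _ _ that]) (use S0 cS in \<open>simp_all add: S_def f_def\<close>)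
  define V where "V = marks_at l {x. psize x = 2*u \<or> psize x = 2*u+1 \<or> x = Overlined (2*u+2)}"
  have so: "sorted l" using l by (simp add: overpartition_def)
  have finS: "finite S" and finA: "finite A" by (simp_all add: S_def A_def)
  have oe: "oe \<longleftrightarrow> Plain (2*u+1) \<in> set l \<or> Overlined (2*u+2) \<in> set l"
    unfolding oe_def f_def by (metis add_gr_0 count_list_0_iff gr0I less_irrefl)
  have a: "f (Overlined (2*u+1)) = 0 \<longleftrightarrow> Overlined (2*u+1) \<notin> set l"
    by (simp add: f_def count_list_0_iff)
  have "marks_at l {Plain (2*u+1), Overlined (2*u+2)} = (if oe then {1} else {})"
    using mark_trivial[of l _ u] unfolding oe by (auto simp: marks_at_def set_conv_nth image_iff)
  moreover have "{x. psize x = 2*u \<or> psize x = 2*u+1 \<or> x = Overlined (2*u+2)}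
      = {x. psize x = 2*u} \<union> {Overlined (2*u+1)} \<union> {Plain (2*u+1), Overlined (2*u+2)}"
    by (auto) (metis part.exhaust_sel part.sel)
  ultimately have V: "V = S \<union> A \<union> (if oe then {1} else {})"
    by (simp only: V_def S_def A_def marks_at_Un)
  let ?m = "\<lambda>q. mark l (p + q)"
  note m = mark_plain[OF so S0 S_def[THEN meta_eq_to_obj_eq], folded f_def p_def V_def oe a]
  note mexS = mex1_pos_notin[OF finS]
  have dis: "A \<inter> S = {}" "0 \<notin> A" using A mexS by (auto split: if_splits)
  have cSA: "card {w \<in> S \<union> A. w \<le> r} = kept_even r f u + kept_overlined r f u" if "1 \<le> r" for r
  proof -
    have "{w \<in> S \<union> A. w \<le> r} = {w \<in> S. w \<le> r} \<union> {w \<in> A. w \<le> r}" by blast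
    moreover have "{w \<in> S. w \<le> r} \<inter> {w \<in> A. w \<le> r} = {}" using dis by blast
    ultimately show ?thesis using cS[OF that] cA[OF that] finS finA by (simp add: card_Un_disjoint)
  qed
  show thesis
  proof (cases "oe \<and> f (Overlined (2*u+1)) = 0 \<and> S \<noteq> {} \<and> 1 \<notin> S")
    case sp: True
    then have "A = {}" using A by simp
    then have V': "V = insert 1 S" using V sp by auto
    have gS: "Min S \<in> S" using finS sp by simp
    have gle: "x \<in> S \<Longrightarrow> Min S \<le> x" for x using finS by simp
    have "Min S \<noteq> 0" "Min S \<noteq> 1" using gS S0 sp by metis+
    then have g2: "2 \<le> Min S" by linarith
    show thesis
    proof (rule that[of "insert 1 S - {Min S}"])
      fix q assume q: "q < f (Plain (2*u+2))"
      show "?m q = mex1 ((insert 1 S - {Min S}) \<union> ?m ` {..<q})"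
      proof (rule special_sequence[OF finS S0 _ _ _ q])
        fix q assume "q < f (Plain (2*u+2))"
        from m[OF this] show "?m q = (if (if q = 0 then 1 else ?m (q - 1)) = Min S - 1 then Min S
               else mex1 (insert 1 S \<union> ?m ` {..<q}))"
          using sp g2 V' by simp
      qed (use sp in auto)
    next
      fix r :: nat assume r: "1 \<le> r"
      have ko: "kept_overlined r f u = 0" using sp by (simp add: kept_overlined_def)
      show "card {w \<in> insert 1 S - {Min S}. w \<le> r} = max (kept_even r f u + kept_overlined r f u) (if oe then 1 else 0)"
      proof (cases "Min S \<le> r")
        case True
        have "{w \<in> insert 1 S - {Min S}. w \<le> r} = insert 1 ({w \<in> S. w \<le> r} - {Min S})"
          using r g2 by auto
        moreover have "card ({w \<in> S. w \<le> r} - {Min S}) = kept_even r f u - 1"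
          using cS[OF r] gS True by simp
        moreover have "0 < kept_even r f u"
          using card_mono[of "{w \<in> S. w \<le> r}" "{Min S}"] cS[OF r] gS True finS by simp
        ultimately show ?thesis using sp ko finS by (simp add: card_insert_if)
      next
        case False
        then have e: "{w \<in> insert 1 S - {Min S}. w \<le> r} = {1}" "{w \<in> S. w \<le> r} = {}"
          using r g2 by (auto dest: gle)
        have "kept_even r f u = 0" using cS[OF r] unfolding e(2) by simp
        then show ?thesis using sp ko unfolding e(1) by simp
      qed
    qed (use finS S0 g2 in auto)
  next
    case False
    have rule: "?m q = mex1 (V \<union> ?m ` {..<q})" if "q < f (Plain (2*u+2))" for q
    proof -
      have "\<not> (S \<noteq> {} \<and> 2 \<le> Min S \<and> oe \<and> f (Overlined (2*u+1)) = 0)"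
      proof
        assume *: "S \<noteq> {} \<and> 2 \<le> Min S \<and> oe \<and> f (Overlined (2*u+1)) = 0"
        then have "1 \<in> S" using False by blast
        then have "Min S \<le> 1" using finS by simp
        then show False using * by simp
      qed
      then show ?thesis by (intro trans[OF m[OF that]] if_not_P) blast
    qed
    show thesis
    proof (rule that[of V])
      fix r :: nat assume r: "1 \<le> r"
      show "card {w \<in> V. w \<le> r} = max (kept_even r f u + kept_overlined r f u) (if oe then 1 else 0)"
      proof (cases "oe \<and> 1 \<notin> S \<union> A")
        case True
        \<comment> \<open>With 1 missing from \<open>S\<close>, an overlined 2u+1 would have taken
          mark 1 itself.\<close>
        have "f (Overlined (2*u+1)) = 0"
        proof (rule ccontr)
          assume "f (Overlined (2*u+1)) \<noteq> 0"
          then have "A = {mex1 S}" using A by simp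
          moreover have "mex1 S = 1" using True by (intro mex1_eqI) auto
          ultimately show False using True by simp
        qed
        then have "S = {}" "A = {}" using A True False by auto
        then have "V = {1}" "kept_even r f u + kept_overlined r f u = 0"
          using V True cSA[OF r] by auto
        moreover have "{w \<in> {1::nat}. w \<le> r} = {1}" using r by auto
        ultimately show ?thesis using True by simp
      next
        case F: False
        then have "V = S \<union> A" using V by auto
        moreover have "1 \<le> card {w \<in> S \<union> A. w \<le> r}" if oe
        proof -
          have "{1} \<subseteq> {w \<in> S \<union> A. w \<le> r}" using F that r by auto
          from card_mono[OF _ this] show ?thesis using finS finA by simp
        qed
        ultimately show ?thesis using cSA[OF r] by auto
      qed
    qed (use V finS finA S0 dis rule in auto)
  qed
qed

text \<open>The marks at size 2u+2 are pairwise distinct: the run is injective, and an overlined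
  2u+2 puts 1 into \<open>W\<close>. So counting marks counts parts, and the one number needed for
  the next column is available.\<close>

lemma column_even:
  fixes l u
  assumes l: "overpartition l"
  defines "f \<equiv> count_list l" and "S \<equiv> \<lambda>u. marks_at l {x. psize x = 2*u}"
  assumes S0: "0 \<notin> S u" and cS: "\<And>r. 1 \<le> r \<Longrightarrow> card {m\<in>S u. m \<le> r} = kept_even r f u"
  shows "1 \<le> r \<Longrightarrow> card {j. j < length l \<and> l ! j = Plain (2*u+2) \<and> mark l j \<le> r} = kept_plain r f u"
    and "0 \<notin> S (Suc u)"
    and "1 \<le> r \<Longrightarrow> card {m\<in>S (Suc u). m \<le> r} = kept_even r f (Suc u)"
proof -
  let ?b = "f (Plain (2*u+2))"
  define p where "p = length (filter (\<lambda>y. y < Plain (2*u+2)) l)"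
  define m where "m = (\<lambda>q. mark l (p + q))"
  define oe where "oe \<longleftrightarrow> 0 < f (Plain (2*u+1)) + f (Overlined (2*u+2))"
  have so: "sorted l" using l by (simp add: overpartition_def)
  obtain W where W: "finite W" "0 \<notin> W" "oe \<Longrightarrow> 1 \<in> W"
    "\<And>q. q < ?b \<Longrightarrow> m q = mex1 (W \<union> m ` {..<q})"
    "\<And>r. 1 \<le> r \<Longrightarrow> card {w\<in>W. w \<le> r} = max (kept_even r f u + kept_overlined r f u) (if oe then 1 else 0)"
    using column_plain[OF l S0[unfolded S_def] cS[unfolded S_def f_def]]
    unfolding m_def p_def oe_def f_def by auto
  have seq: "inj_on m {..<?b}" "m ` {..<?b} \<inter> W = {}" "0 \<notin> m ` {..<?b}"
    "\<And>r. card {i. i < ?b \<and> m i \<le> r} = min ?b (r - card {w\<in>W. 0 < w \<and> w \<le> r})"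
    using mex1_sequence[OF W(1), of ?b m] W(4) by blast+
  have c: "card {i. i < ?b \<and> m i \<le> r} = kept_plain r f u" if "1 \<le> r" for r
  proof -
    have "{w\<in>W. 0 < w \<and> w \<le> r} = {w\<in>W. w \<le> r}" using W(2) by (auto intro!: gr0I)
    then show ?thesis using seq(4)[of r] W(5)[OF that] by (simp add: kept_plain_def oe_def)
  qed
  have pos: "{j. j < length l \<and> l ! j = Plain (2*u+2)} = (+) p ` {..<?b}"
  proof (intro set_eqI iffI)
    fix j assume "j \<in> {j. j < length l \<and> l ! j = Plain (2*u+2)}"
    then have "p \<le> j" "j < p + ?b"
      using sorted_index(2)[OF so, of j "Plain (2*u+2)"] by (simp_all add: p_def f_def)
    then show "j \<in> (+) p ` {..<?b}" by (intro image_eqI[of _ _ "j - p"]) auto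
  next
    fix j assume "j \<in> (+) p ` {..<?b}"
    then have j: "p \<le> j" "j < p + ?b" by auto
    then have "j < length l" using sorted_index_bound[OF so, of "Plain (2*u+2)"] by (simp add: p_def f_def)
    then show "j \<in> {j. j < length l \<and> l ! j = Plain (2*u+2)}"
      using sorted_index(2)[OF so, of j "Plain (2*u+2)"] j by (simp add: p_def f_def)
  qed
  have "{j. j < length l \<and> l ! j = Plain (2*u+2) \<and> mark l j \<le> r} = (+) p ` {i. i < ?b \<and> m i \<le> r}" for r
  proof -
    have "{j. j < length l \<and> l ! j = Plain (2*u+2) \<and> mark l j \<le> r}
        = {j. j < length l \<and> l ! j = Plain (2*u+2)} \<inter> {j. mark l j \<le> r}" by blast
    also have "\<dots> = (+) p ` {i. i < ?b \<and> m i \<le> r}" unfolding pos by (auto simp: m_def)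
    finally show ?thesis .
  qed
  then show "1 \<le> r \<Longrightarrow> card {j. j < length l \<and> l ! j = Plain (2*u+2) \<and> mark l j \<le> r} = kept_plain r f u"
    using c by (simp add: card_image)
  have Q: "marks_at l {Plain (2*u+2)} = m ` {..<?b}"
    unfolding marks_at_def singleton_iff pos by (simp add: image_image m_def)
  have E: "marks_at l {Overlined (2*u+2)} = (if f (Overlined (2*u+2)) = 0 then {} else {1})"
    using mark_trivial[of l _ u] count_list_0_iff[of l "Overlined (2*u+2)"]
    by (auto simp: marks_at_def set_conv_nth image_iff f_def)
  have "{x. psize x = 2 * Suc u} = {Overlined (2*u+2)} \<union> {Plain (2*u+2)}"
    by auto (metis part.exhaust_sel)
  then have S: "S (Suc u) = (if f (Overlined (2*u+2)) = 0 then {} else {1}) \<union> m ` {..<?b}"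
    unfolding S_def by (simp only: marks_at_Un E Q)
  then show "0 \<notin> S (Suc u)" using seq(3) by (simp split: if_splits)
  assume r: "1 \<le> r"
  have "f (Overlined (2*u+2)) \<le> 1" using l by (simp add: overpartition_def f_def)
  moreover have "card {x \<in> m ` {..<?b}. x \<le> r} = kept_plain r f u"
  proof -
    have "{x \<in> m ` {..<?b}. x \<le> r} = m ` {i. i < ?b \<and> m i \<le> r}" by auto
    moreover have "inj_on m {i. i < ?b \<and> m i \<le> r}" by (rule inj_on_subset[OF seq(1)]) auto
    ultimately show ?thesis using c[OF r] by (simp add: card_image)
  qed
  moreover have "{x \<in> S (Suc u). x \<le> r} = insert 1 {x \<in> m ` {..<?b}. x \<le> r} \<and> 1 \<notin> m ` {..<?b}"
    if "f (Overlined (2*u+2)) \<noteq> 0"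
  proof
    show "{x \<in> S (Suc u). x \<le> r} = insert 1 {x \<in> m ` {..<?b}. x \<le> r}" using S r that by auto
    have "1 \<in> W" using W(3) that by (simp add: oe_def)
    then show "1 \<notin> m ` {..<?b}" using seq(2) by blast
  qed
  moreover have "S (Suc u) = m ` {..<?b}" if "f (Overlined (2*u+2)) = 0" using S that by simp
  ultimately show "card {m\<in>S (Suc u). m \<le> r} = kept_even r f (Suc u)"
    unfolding kept_even_Suc by (cases "f (Overlined (2*u+2)) = 0") auto
qed

section \<open>Numbers of parts with mark at most r\<close>

lemma marks_even:
  assumes "overpartition l"
  shows "0 \<notin> marks_at l {x. psize x = 2*u} \<and>
    (\<forall>r\<ge>1. card {m \<in> marks_at l {x. psize x = 2*u}. m \<le> r} = kept_even r (count_list l) u)"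
proof (induction u)
  case 0
  have "marks_at l {x. psize x = 2*0} = {}"
    unfolding marks_at_empty_iff using assms by (auto simp: overpartition_def)
  then show ?case by simp
next
  case (Suc u)
  then show ?case using column_even(2,3)[OF assms] by blast
qed

lemma column_total:
  assumes "overpartition l" "1 \<le> r"
  shows "card {j. j < length l \<and> (psize (l ! j) = 2*u+1 \<or> psize (l ! j) = 2*u+2) \<and> mark l j \<le> r}
    = kept r (count_list l) u"
proof -
  let ?M = "\<lambda>x. {j. j < length l \<and> l ! j = x \<and> mark l j \<le> r}"
  note me = marks_even[OF assms(1), of u]
  have "{j. j < length l \<and> (psize (l ! j) = 2*u+1 \<or> psize (l ! j) = 2*u+2) \<and> mark l j \<le> r}
      = ?M (Overlined (2*u+1)) \<union> ?M (Plain (2*u+1)) \<union> ?M (Overlined (2*u+2)) \<union> ?M (Plain (2*u+2))"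
    (is "?L = ?A \<union> ?B \<union> ?C \<union> ?D")
    by (auto) (metis part.exhaust_sel)+
  moreover have "card (?A \<union> ?B \<union> ?C \<union> ?D) = card ?A + card ?B + card ?C + card ?D"
    by (subst card_Un_disjoint, simp, simp, force)+ simp
  moreover have "card ?A = kept_overlined r (count_list l) u"
    using column_overlined(1)[OF assms(1) _ _ assms(2)] me by blast
  moreover have "card ?D = kept_plain r (count_list l) u"
    using column_even(1)[OF assms(1) _ _ assms(2)] me by blast
  ultimately show ?thesis
    using marked_trivial[of "Plain (2*u+1)" u r l] marked_trivial[of "Overlined (2*u+2)" u r l] assms(2)
    by (simp add: kept_def)
qed

lemma mark_pos: "0 < mark l p"
proof -
  have fin: "finite {mark l j | j. j < p \<and> Q j}" for Q by simp
  show ?thesis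
    by (subst mark_unfold) (auto simp: Let_def split: part.splits intro!: mex1_pos_notin(1) fin)
qed

lemma length_filter_marking: "length (filter (\<lambda>m. m \<le> r) (GG_marking l)) = card {j. j < length l \<and> mark l j \<le> r}"
  by (auto simp: GG_marking_def marks_upto_eq length_filter_conv_card intro!: arg_cong[where f = card])

text \<open>The case \<open>r = 0\<close> is separate because \<open>kept 0\<close> would still
  count the parts whose mark is always 1.\<close>

lemma marked_total:
  assumes "overpartition l" "\<forall>x\<in>set l. psize x \<le> 2*U"
  shows "length (filter (\<lambda>m. m \<le> r) (GG_marking l)) = (if r = 0 then 0 else \<Sum>u<U. kept r (count_list l) u)"
proof (cases "r = 0")
  case True
  then show ?thesis using mark_pos[of l] unfolding length_filter_marking True by simp
next
  case False
  have sum: "card {j. j < length l \<and> psize (l ! j) \<le> 2*V \<and> mark l j \<le> r} = (\<Sum>u<V. kept r (count_list l) u)" for V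
  proof (induction V)
    case 0
    have "{j. j < length l \<and> psize (l ! j) \<le> 2*0 \<and> mark l j \<le> r} = {}"
      using assms(1) by (auto simp: overpartition_def)
    then show ?case by simp
  next
    case (Suc V)
    have "{j. j < length l \<and> psize (l ! j) \<le> 2 * Suc V \<and> mark l j \<le> r} =
        {j. j < length l \<and> psize (l ! j) \<le> 2*V \<and> mark l j \<le> r} \<union>
        {j. j < length l \<and> (psize (l ! j) = 2*V+1 \<or> psize (l ! j) = 2*V+2) \<and> mark l j \<le> r}"
      by auto
    moreover have "card ({j. j < length l \<and> psize (l ! j) \<le> 2*V \<and> mark l j \<le> r} \<union>
        {j. j < length l \<and> (psize (l ! j) = 2*V+1 \<or> psize (l ! j) = 2*V+2) \<and> mark l j \<le> r}) =
        card {j. j < length l \<and> psize (l ! j) \<le> 2*V \<and> mark l j \<le> r} +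
        card {j. j < length l \<and> (psize (l ! j) = 2*V+1 \<or> psize (l ! j) = 2*V+2) \<and> mark l j \<le> r}"
      by (rule card_Un_disjoint) auto
    ultimately show ?case using Suc column_total[OF assms(1), of r V] False by simp
  qed
  have eq: "{j. j < length l \<and> psize (l ! j) \<le> 2*U \<and> mark l j \<le> r} = {j. j < length l \<and> mark l j \<le> r}"
    using assms(2) by auto
  show ?thesis using sum[of U] False unfolding length_filter_marking eq by simp
qed

lemma length_filter_Suc:
  "length (filter (\<lambda>m. m \<le> Suc r) ms) = length (filter (\<lambda>m. m \<le> r) ms) + count_list ms (Suc r)"
  by (induction ms) (auto simp: le_Suc_eq)

section \<open>Raising preserves the marks\<close>

definition reg :: "nat \<Rightarrow> part" where
  "reg n = (if even n then Plain n else Overlined n)"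

definition irr :: "nat \<Rightarrow> part" where
  "irr n = (if even n then Overlined n else Plain n)"

lemma psize_reg [simp]: "psize (reg n) = n" and psize_irr [simp]: "psize (irr n) = n"
  by (simp_all add: reg_def irr_def)

lemma F_part_reg [simp]: "F_part (reg n)" and F_part_irr [simp]: "\<not> F_part (irr n)"
  by (simp_all add: reg_def irr_def F_part_def)

lemma F_part_iff: "F_part x \<longleftrightarrow> x = reg (psize x)" and not_F_part_iff: "\<not> F_part x \<longleftrightarrow> x = irr (psize x)"
  by (cases x; auto simp: reg_def irr_def F_part_def)+

lemma reg_irr_cases:
  obtains "x = reg (psize x)" "F_part x" | "x = irr (psize x)" "\<not> F_part x"
  using F_part_iff not_F_part_iff by blast

lemma reg_inj [simp]: "reg m = reg n \<longleftrightarrow> m = n" and irr_inj [simp]: "irr m = irr n \<longleftrightarrow> m = n"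
  by (metis psize_reg) (metis psize_irr)

lemma reg_neq_irr [simp]: "reg m \<noteq> irr n" "irr n \<noteq> reg m"
  by (metis F_part_irr F_part_reg)+

lemma column_parts:
  "Overlined (2*u+1) = reg (2*u+1)" "Plain (2*u+1) = irr (2*u+1)"
  "Overlined (2*u+2) = irr (2*u+2)" "Plain (2*u+2) = reg (2*u+2)"
  by (simp_all add: reg_def irr_def)

text \<open>
  A regular part can be selected for \<open>r = 1\<close> after a selected part of size \<open>x\<close>, regular or not, iff its
  size is at least \<open>nx x\<close>.
\<close>

definition nx :: "nat \<Rightarrow> nat" where
  "nx x = 2 * (x div 2) + 3"

lemma nx_mono: "x \<le> y \<Longrightarrow> nx x \<le> nx y"
  by (simp add: nx_def div_le_mono)

lemma nx_gt: "x + 2 \<le> nx x" and nx_le: "nx x \<le> x + 3"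
  by (simp_all add: nx_def)

lemma nx_odd: "odd x \<Longrightarrow> nx x = x + 2" and nx_even: "even x \<Longrightarrow> nx x = x + 3"
  by (auto simp: nx_def elim!: oddE evenE)

lemma nx_add2: "nx (x + 2) = nx x + 2"
  by (simp add: nx_def)

text \<open>Stated for all pairs instead of neighbours, which is equivalent and passes to subsets at
  once.\<close>

definition spread :: "nat set \<Rightarrow> bool" where
  "spread T \<longleftrightarrow> (\<forall>x\<in>T. \<forall>y\<in>T. x < y \<longrightarrow> nx x \<le> y)"

lemma kept_even_cong:
  "(\<And>x. psize x \<le> 2*u \<Longrightarrow> f x = g x) \<Longrightarrow> kept_even r f u = kept_even r g u"
  by (induction u) (auto simp: kept_even.simps(2))

lemma kept_cong:
  assumes "\<And>x. psize x \<le> 2*u+2 \<Longrightarrow> f x = g x"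
  shows "kept r f u = kept r g u"
  using assms kept_even_cong[of u f g r] by (simp add: kept_def kept_plain_def kept_overlined_def)

text \<open>An overlined even part is always counted, but it also makes the maximum in
  \<open>kept_plain\<close> at least 1, which leaves a slot for it.\<close>

lemma kept_even_le:
  assumes "1 \<le> r" "\<And>t. f (Overlined t) \<le> 1"
  shows "kept_even r f u \<le> r"
proof (cases u)
  case (Suc v)
  have "f (Overlined (2*v+2)) = 0 \<or> f (Overlined (2*v+2)) = 1"
    using assms(2)[of "2*v+2"] by linarith
  then show ?thesis using assms(1) Suc by (auto simp: kept_even.simps(2) max_def min_def)
qed simp

text \<open>
  The relation between the greedy selections before (\<open>c\<close>, \<open>K\<close>) and after (\<open>c'\<close>, \<open>K'\<close>) raising, where
  \<open>c\<close> counts the selected parts of size \<open>2u+2\<close> and \<open>K\<close> those of size at most \<open>2u+2\<close>.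
\<close>

definition raise_inv :: "nat \<Rightarrow> nat set \<Rightarrow> nat \<Rightarrow> nat \<Rightarrow> nat \<Rightarrow> nat \<Rightarrow> nat \<Rightarrow> bool" where
  "raise_inv r T u c c' K K' \<longleftrightarrow>
    (if 2*u+2 \<in> T then K = K' + 1 \<and> c = c' + 1 \<and> c \<le> r \<or> K = K' \<and> c = r \<and> c' = r
     else if 2*u+1 \<in> T then K = K' + 1 \<and> c' = c \<and> c < r \<or> K = K' \<and> c + 1 = r \<and> c' = r
     else K = K' \<and> (c' = c + 1 \<and> c < r \<or> c = 0 \<and> c' = 0))"

text \<open>Multiplicity functions suffice here: \<open>P\<close> is what stays, \<open>f\<close>
  and \<open>f'\<close> are the multiplicities before and after the step. The assumption
  \<open>blocked\<close> makes \<open>T\<close> the greedy chain that starts at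
  \<open>irr s\<close>: beyond this part, whatever stays is regular and too close above some element
  of \<open>T\<close>.\<close>

locale raise =
  fixes P :: "part \<Rightarrow> nat" and s :: nat and T :: "nat set" and f f' :: "part \<Rightarrow> nat"
  assumes s_T: "s \<in> T" and s_min: "x \<in> T \<Longrightarrow> s \<le> x" and s_pos: "0 < s"
    and spread: "spread T"
    and blocked: "0 < P y \<Longrightarrow> y \<le> irr s \<or> F_part y \<and> (\<exists>x\<in>T. x \<le> psize y \<and> psize y < nx x)"
    and f_reg: "f (reg n) = P (reg n) + (if n \<in> T \<and> n \<noteq> s then 1 else 0)"
    and f_irr: "f (irr n) = P (irr n) + (if n = s then 1 else 0)"
    and f'_reg: "f' (reg n) = P (reg n) + (if 2 \<le> n \<and> n - 2 \<in> T then 1 else 0)"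
    and f'_irr: "f' (irr n) = P (irr n)"
    and overlined_le: "f (Overlined t) \<le> 1"
begin

lemma spreadD: "x \<in> T \<Longrightarrow> y \<in> T \<Longrightarrow> x < y \<Longrightarrow> nx x \<le> y"
  using spread by (auto simp: spread_def)

lemma P_irr: "s < n \<Longrightarrow> P (irr n) = 0"
  using blocked[of "irr n"] by (auto simp: less_eq_part_def)

lemma P_reg: "s < n \<Longrightarrow> 0 < P (reg n) \<Longrightarrow> \<exists>x\<in>T. x \<le> n \<and> n < nx x"
  using blocked[of "reg n"] by (auto simp: less_eq_part_def)

lemma agree_below: "psize x < s \<Longrightarrow> f x = f' x"
proof -
  assume x: "psize x < s"
  then have "psize x \<notin> T" "psize x - 2 \<notin> T" using s_min by fastforce+
  then have "f (reg (psize x)) = f' (reg (psize x))" "f (irr (psize x)) = f' (irr (psize x))"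
    using f_reg[of "psize x"] f'_reg[of "psize x"] f_irr[of "psize x"] f'_irr[of "psize x"] x
    by auto
  then show "f x = f' x" by (metis reg_irr_cases)
qed

text \<open>Below \<open>s\<close> nothing changes. In the column of \<open>s\<close>, losing the
  irregular part lowers the count by 1, unless this part was the only reason for the 1 in the
  maximum of \<open>kept_plain\<close> and a further plain 2t+2 takes the freed slot. This is the
  second alternative in \<open>raise_inv\<close>.\<close>

lemma raise_inv_start:
  assumes r: "1 \<le> r" and t: "s = 2*t+1 \<or> s = 2*t+2"
  shows "raise_inv r T t (kept_even r f (Suc t)) (kept_even r f' (Suc t))
    (\<Sum>u<Suc t. kept r f u) (\<Sum>u<Suc t. kept r f' u)"
proof -
  have c: "kept_even r f t = kept_even r f' t"
    by (rule kept_even_cong, rule agree_below) (use t in auto)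
  have K: "(\<Sum>u<t. kept r f u) = (\<Sum>u<t. kept r f' u)"
    by (rule sum.cong[OF refl], rule kept_cong, rule agree_below) (use t in auto)
  have le: "kept_even r f t \<le> r" using kept_even_le[OF r, of f] overlined_le by blast
  have n2: "2*t+2-2 \<notin> T" "2*t+1-2 \<notin> T" using s_min[of "2*t"] s_min[of "2*t-1"] t s_pos by auto
  have a: "f (Overlined (2*t+1)) = f' (Overlined (2*t+1))"
    using f_reg[of "2*t+1"] f'_reg[of "2*t+1"] n2 t s_min[of "2*t+1"] unfolding column_parts by auto
  have a1: "f (Overlined (2*t+1)) \<le> 1" by (rule overlined_le)
  have n3: "2*t+2 \<notin> T" if "s = 2*t+1" using spreadD[OF s_T, of "2*t+2"] that by (auto simp: nx_def)
  have b: "f (Plain (2*t+2)) = f' (Plain (2*t+2))"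
    using f_reg[of "2*t+2"] f'_reg[of "2*t+2"] n2 n3 t unfolding column_parts by auto
  define k al x where "k = kept_even r f t" and "al = min (f (Overlined (2*t+1))) (r - k)"
    and "x = f (Plain (2*t+2))"
  have kp: "kept_even r g (Suc t) = g (Overlined (2*t+2)) +
      min x (r - max (k + al) (if 0 < g (Plain (2*t+1)) + g (Overlined (2*t+2)) then 1 else 0))"
    "(\<Sum>u<Suc t. kept r g u) = (\<Sum>u<t. kept r f u) + al + g (Plain (2*t+1)) + kept_even r g (Suc t)"
    if "g = f \<or> g = f'" for g
  proof -
    have g: "kept_even r g t = k" "kept_overlined r g t = al" "g (Plain (2*t+2)) = x"
      "(\<Sum>u<t. kept r g u) = (\<Sum>u<t. kept r f u)"
      using that c K a b by (auto simp: k_def al_def x_def kept_overlined_def)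
    then show "kept_even r g (Suc t) = g (Overlined (2*t+2)) +
      min x (r - max (k + al) (if 0 < g (Plain (2*t+1)) + g (Overlined (2*t+2)) then 1 else 0))"
      unfolding kept_even_Suc kept_plain_def by simp
    show "(\<Sum>u<Suc t. kept r g u) = (\<Sum>u<t. kept r f u) + al + g (Plain (2*t+1)) + kept_even r g (Suc t)"
      unfolding sum.lessThan_Suc g(4) kept_def[of r g t] kept_even_Suc g(2) by simp
  qed
  have kal: "k + al \<le> r" using le by (simp add: al_def k_def)
  show ?thesis using t
  proof
    assume s: "s = 2*t+1"
    have e: "f (Overlined (2*t+2)) = 0" "f' (Overlined (2*t+2)) = 0"
      using f_irr[of "2*t+2"] f'_irr[of "2*t+2"] P_irr[of "2*t+2"] s unfolding column_parts by auto
    have o: "f (Plain (2*t+1)) = f' (Plain (2*t+1)) + 1"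
      using f_irr[of "2*t+1"] f'_irr[of "2*t+1"] s unfolding column_parts by auto
    have T: "2*t+1 \<in> T" "2*t+2 \<notin> T" using n3[OF s] s_T s by auto
    show ?thesis
      unfolding raise_inv_def kp(2)[OF disjI1[OF refl]] kp(2)[OF disjI2[OF refl]]
        kp(1)[OF disjI1[OF refl]] kp(1)[OF disjI2[OF refl]]
        e o using kal r T by (auto simp: min_def max_def)
  next
    assume s: "s = 2*t+2"
    have "f (Overlined (2*t+2)) = f' (Overlined (2*t+2)) + 1"
      using f_irr[of "2*t+2"] f'_irr[of "2*t+2"] s unfolding column_parts by auto
    then have e: "f (Overlined (2*t+2)) = 1" "f' (Overlined (2*t+2)) = 0"
      using overlined_le[of "2*t+2"] by auto
    have o: "f (Plain (2*t+1)) = f' (Plain (2*t+1))"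
      using f_irr[of "2*t+1"] f'_irr[of "2*t+1"] s unfolding column_parts by auto
    have T: "2*t+2 \<in> T" using s_T s by auto
    show ?thesis
      unfolding raise_inv_def kp(2)[OF disjI1[OF refl]] kp(2)[OF disjI2[OF refl]]
        kp(1)[OF disjI1[OF refl]] kp(1)[OF disjI2[OF refl]]
        e o using kal r T by (auto simp: min_def max_def)
  qed
qed

text \<open>Beyond \<open>s\<close> there are no irregular parts, so the maximum disappears and a
  column just fills \<open>r\<close> slots, the overlined odd part before the plain even ones. A
  moved part appears one column later after the step than before it; the lag of at most 1 between
  \<open>K\<close> and \<open>K'\<close> records this.\<close>

lemma raise_inv_step:
  assumes r: "1 \<le> r" and u: "s \<le> 2*u+2"
    and inv: "raise_inv r T u (kept_even r f (Suc u)) (kept_even r f' (Suc u)) K K'"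
  shows "raise_inv r T (Suc u) (kept_even r f (Suc (Suc u))) (kept_even r f' (Suc (Suc u)))
    (K + kept r f (Suc u)) (K' + kept r f' (Suc u))"
proof -
  define c c' where "c = kept_even r f (Suc u)" and "c' = kept_even r f' (Suc u)"
  define a b a' b' where "a = f (Overlined (2*u+3))" and "b = f (Plain (2*u+4))"
    and "a' = f' (Overlined (2*u+3))" and "b' = f' (Plain (2*u+4))"
  have cp: "Overlined (2*u+3) = reg (2*u+3)" "Plain (2*u+3) = irr (2*u+3)"
    "Overlined (2*u+4) = irr (2*u+4)" "Plain (2*u+4) = reg (2*u+4)"
    by (simp_all add: reg_def irr_def)
  have z: "f (Plain (2*u+3)) = 0" "f' (Plain (2*u+3)) = 0" "f (Overlined (2*u+4)) = 0" "f' (Overlined (2*u+4)) = 0"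
    using f_irr[of "2*u+3"] f'_irr[of "2*u+3"] P_irr[of "2*u+3"]
      f_irr[of "2*u+4"] f'_irr[of "2*u+4"] P_irr[of "2*u+4"] u unfolding cp by auto
  have step: "kept r g (Suc u) = min (g (Overlined (2*u+3))) (r - kept_even r g (Suc u)) +
      min (g (Plain (2*u+4))) (r - (kept_even r g (Suc u) + min (g (Overlined (2*u+3))) (r - kept_even r g (Suc u))))"
    "kept_even r g (Suc (Suc u)) =
      min (g (Plain (2*u+4))) (r - (kept_even r g (Suc u) + min (g (Overlined (2*u+3))) (r - kept_even r g (Suc u))))"
    if "g (Plain (2*u+3)) = 0" "g (Overlined (2*u+4)) = 0" for g
  proof -
    have n: "2 * Suc u + 1 = 2*u+3" "2 * Suc u + 2 = 2*u+4" by simp_all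
    show "kept r g (Suc u) = min (g (Overlined (2*u+3))) (r - kept_even r g (Suc u)) +
      min (g (Plain (2*u+4))) (r - (kept_even r g (Suc u) + min (g (Overlined (2*u+3))) (r - kept_even r g (Suc u))))"
      unfolding kept_def kept_plain_def kept_overlined_def n that by simp
    show "kept_even r g (Suc (Suc u)) =
      min (g (Plain (2*u+4))) (r - (kept_even r g (Suc u) + min (g (Overlined (2*u+3))) (r - kept_even r g (Suc u))))"
      unfolding kept_even_Suc[of r g "Suc u"] kept_plain_def kept_overlined_def n that by simp
  qed
  have k: "kept r f (Suc u) = min a (r - c) + min b (r - (c + min a (r - c)))"
      "kept_even r f (Suc (Suc u)) = min b (r - (c + min a (r - c)))"
      "kept r f' (Suc u) = min a' (r - c') + min b' (r - (c' + min a' (r - c')))"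
      "kept_even r f' (Suc (Suc u)) = min b' (r - (c' + min a' (r - c')))"
    using step[OF z(1,3)] step[OF z(2,4)] unfolding a_def b_def a'_def b'_def c_def c'_def by blast+
  let ?E = "2*u+2 \<in> T" and ?O = "2*u+1 \<in> T" and ?A = "2*u+3 \<in> T" and ?B = "2*u+4 \<in> T"
  have n: "2*u+3-2 = 2*u+1" "2*u+4-2 = 2*u+2" by simp_all
  define pa pb where "pa = P (reg (2*u+3))" and "pb = P (reg (2*u+4))"
  have ab: "a = pa + (if ?A then 1 else 0)" "b = pb + (if ?B then 1 else 0)"
    "a' = pa + (if ?O then 1 else 0)" "b' = pb + (if ?E then 1 else 0)"
    using f_reg[of "2*u+3"] f_reg[of "2*u+4"] f'_reg[of "2*u+3"] f'_reg[of "2*u+4"] u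
    unfolding a_def b_def a'_def b'_def cp pa_def pb_def n by simp_all
  have a1: "a \<le> 1" unfolding a_def by (rule overlined_le)
  have sp: "\<not> (?E \<and> ?A)" "\<not> (?E \<and> ?B)" "\<not> (?O \<and> ?E)" "\<not> (?A \<and> ?B)"
    using spreadD[of "2*u+2" "2*u+3"] spreadD[of "2*u+2" "2*u+4"] spreadD[of "2*u+1" "2*u+2"]
      spreadD[of "2*u+3" "2*u+4"] by (auto simp: nx_def)
  \<comment> \<open>A second overlined 2u+3 is impossible, so an untouched one can be covered only
    by 2u+2.\<close>
  have pa: "pa = 0" if "\<not> ?E"
  proof (rule ccontr)
    assume "pa \<noteq> 0"
    then obtain x where x: "x \<in> T" "x \<le> 2*u+3" "2*u+3 < nx x" using P_reg[of "2*u+3"] u pa_def by auto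
    then have "x = 2*u+3 \<or> x = 2*u+2" unfolding nx_def by presburger
    then have "?A" using x that by auto
    then show False using ab(1) a1 \<open>pa \<noteq> 0\<close> by simp
  qed
  have pb: "?A \<or> ?B" if nE: "\<not> ?E" "pb \<noteq> 0"
  proof -
    obtain x where x: "x \<in> T" "x \<le> 2*u+4" "2*u+4 < nx x" using P_reg[of "2*u+4"] u pb_def nE(2) by auto
    then have "x = 2*u+3 \<or> x = 2*u+2 \<or> x = 2*u+4" unfolding nx_def by presburger
    then show ?thesis using x nE by auto
  qed
  have n': "2 * Suc u + 1 = 2*u+3" "2 * Suc u + 2 = 2*u+4" by simp_all
  note inv' = inv[unfolded raise_inv_def, folded c_def c'_def]
  show ?thesis
    unfolding raise_inv_def k n'
    using inv' ab a1 sp pa pb r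
    by (cases ?E; cases ?O; cases ?A; cases ?B) (auto simp: min_def split: if_splits)
qed

lemma raise_inv_all:
  assumes "1 \<le> r" "s \<le> 2*u+2"
  shows "raise_inv r T u (kept_even r f (Suc u)) (kept_even r f' (Suc u))
    (\<Sum>u<Suc u. kept r f u) (\<Sum>u<Suc u. kept r f' u)"
  using assms(2)
proof (induction u)
  case 0
  show ?case by (rule raise_inv_start[OF assms(1)]) (use 0 s_pos in linarith)
next
  case (Suc u)
  show ?case
  proof (cases "s \<le> 2*u+2")
    case True
    from raise_inv_step[OF assms(1) True Suc.IH[OF True]] show ?thesis by simp
  next
    case False
    then have "s = 2 * Suc u + 1 \<or> s = 2 * Suc u + 2" using Suc.prems by presburger
    then show ?thesis by (rule raise_inv_start[OF assms(1)])
  qed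
qed

text \<open>In a column beyond \<open>T\<close> every moved part has arrived, and only the branch of
  \<open>raise_inv\<close> with \<open>K = K'\<close> remains.\<close>

lemma kept_raise_eq:
  assumes "1 \<le> r" "\<And>x. x \<in> T \<Longrightarrow> x \<le> 2*u"
  shows "(\<Sum>u<Suc u. kept r f u) = (\<Sum>u<Suc u. kept r f' u)"
  using raise_inv_all[OF assms(1), of u] assms(2)[OF s_T] assms(2)[of "2*u+2"] assms(2)[of "2*u+1"]
  by (auto simp: raise_inv_def split: if_splits)

end

section \<open>Chains of 1-marked parts\<close>

lemma spread_insert: "spread T \<Longrightarrow> (\<And>x. x \<in> T \<Longrightarrow> nx w \<le> x) \<Longrightarrow> spread (insert w T)"
  unfolding spread_def using nx_gt[of w] by fastforce

lemma spread_subset: "spread T \<Longrightarrow> S \<subseteq> T \<Longrightarrow> spread S"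
  unfolding spread_def by blast

lemma spread_add2: "spread ((\<lambda>x. x + 2) ` T) \<longleftrightarrow> spread T"
  by (auto simp: spread_def nx_add2[simplified])

text \<open>One \<open>x\<close> covers at most one member of \<open>D\<close>: after a member
  \<open>d \<ge> x\<close> the next one is at least \<open>nx d \<ge> nx x\<close>. Applied to a
  greedy chain, this shows that no spread set of selectable sizes is longer.\<close>

lemma card_le_left_cover:
  assumes "finite T" "spread D" "\<And>d. d \<in> D \<Longrightarrow> \<exists>x\<in>T. x \<le> d \<and> d < nx x"
  shows "card D \<le> card T"
proof -
  obtain h where h: "\<And>d. d \<in> D \<Longrightarrow> h d \<in> T \<and> h d \<le> d \<and> d < nx (h d)" using assms(3) by metis
  have "h d < h d'" if "d \<in> D" "d' \<in> D" "d < d'" for d d'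
  proof (rule ccontr)
    assume "\<not> h d < h d'"
    then have "h d' \<le> d" using h[OF that(1)] by linarith
    then have "nx (h d') \<le> d'" using nx_mono[of "h d'" d] assms(2) that unfolding spread_def by fastforce
    then show False using h[OF that(2)] by linarith
  qed
  then have "inj_on h D" by (intro linorder_inj_onI) (auto dest: less_imp_neq)
  then show ?thesis using card_inj_on_le[of h D T] h assms(1) by blast
qed

text \<open>The mirror image: a common \<open>x\<close> for \<open>d < d'\<close> would give
  \<open>d' \<le> x < nx d\<close>, against the spread of \<open>D\<close>.\<close>

lemma card_le_right_cover:
  assumes "finite T" "spread D" "\<And>d. d \<in> D \<Longrightarrow> \<exists>x\<in>T. d \<le> x \<and> x < nx d"
  shows "card D \<le> card T"
proof -
  obtain h where h: "\<And>d. d \<in> D \<Longrightarrow> h d \<in> T \<and> d \<le> h d \<and> h d < nx d" using assms(3) by metis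
  have "h d < h d'" if "d \<in> D" "d' \<in> D" "d < d'" for d d'
    using h[OF that(1)] h[OF that(2)] assms(2) that unfolding spread_def by fastforce
  then have "inj_on h D" by (intro linorder_inj_onI) (auto dest: less_imp_neq)
  then show ?thesis using card_inj_on_le[of h D T] h assms(1) by blast
qed

text \<open>Greedy selection from the left: the induction adds the largest element and keeps it
  exactly if no chosen element covers it.\<close>

lemma left_cover_exists:
  assumes "finite Y" "\<And>y. y \<in> Y \<Longrightarrow> s < y"
  shows "\<exists>T. finite T \<and> s \<in> T \<and> T \<subseteq> insert s Y \<and> spread T \<and> (\<forall>y\<in>Y. \<exists>x\<in>T. x \<le> y \<and> y < nx x)"
  using assms
proof (induction Y rule: finite_linorder_max_induct)
  case empty
  show ?case by (rule exI[of _ "{s}"]) (auto simp: spread_def)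
next
  case (insert b A)
  then obtain T where T: "finite T" "s \<in> T" "T \<subseteq> insert s A" "spread T"
      "\<forall>y\<in>A. \<exists>x\<in>T. x \<le> y \<and> y < nx x" by auto
  have b: "x < b" if "x \<in> T" for x using that T(3) insert.hyps(2) insert.prems by auto
  show ?case
  proof (cases "\<exists>x\<in>T. b < nx x")
    case True
    then have "\<exists>x\<in>T. x \<le> b \<and> b < nx x" using b less_imp_le by blast
    then show ?thesis using T by (intro exI[of _ T]) auto
  next
    case False
    have "spread (insert b T)" using T(4) b False unfolding spread_def by (auto dest: less_asym simp: not_less)
    moreover have "b < nx b" using nx_gt[of b] by linarith
    ultimately show ?thesis using T by (intro exI[of _ "insert b T"]) auto
  qed
qed

text \<open>Greedy selection from the right, hence an induction that adds the smallest
  element.\<close>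

lemma right_cover_exists:
  assumes "finite Z"
  shows "\<exists>C. C \<subseteq> Z \<and> spread C \<and> (\<forall>y\<in>Z. \<exists>z\<in>C. y \<le> z \<and> z < nx y)"
  using assms
proof (induction Z rule: finite_linorder_min_induct)
  case empty
  show ?case by (simp add: spread_def)
next
  case (insert b A)
  then obtain C where C: "C \<subseteq> A" "spread C" "\<forall>y\<in>A. \<exists>z\<in>C. y \<le> z \<and> z < nx y" by auto
  show ?case
  proof (cases "\<exists>z\<in>C. z < nx b")
    case True
    then have "\<exists>z\<in>C. b \<le> z \<and> z < nx b" using C(1) insert.hyps(2) less_imp_le by blast
    then show ?thesis using C by (intro exI[of _ C]) auto
  next
    case False
    have "spread (insert b C)" using C(2) False by (intro spread_insert) auto
    moreover have "b < nx b" using nx_gt[of b] by linarith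
    ultimately show ?thesis using C by (intro exI[of _ "insert b C"]) auto
  qed
qed

lemma top_elements:
  fixes C :: "nat set"
  assumes "finite C" "j \<le> card C"
  shows "\<exists>D\<subseteq>C. card D = j \<and> (\<forall>x\<in>D. \<forall>y\<in>C - D. y < x)"
  using assms
proof (induction C rule: finite_linorder_min_induct)
  case (insert b A)
  show ?case
  proof (cases "j \<le> card A")
    case True
    then obtain D where "D \<subseteq> A" "card D = j" "\<forall>x\<in>D. \<forall>y\<in>A - D. y < x" using insert by auto
    then show ?thesis using insert.hyps(2) by (intro exI[of _ D]) auto
  next
    case False
    then have "card (insert b A) = j" using insert by (auto simp: card_insert_if)
    then show ?thesis by (intro exI[of _ "insert b A"]) auto
  qed
qed simp

section \<open>Multisets before and after a raising step\<close>

definition op_mset :: "part multiset \<Rightarrow> bool" where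
  "op_mset M \<longleftrightarrow> (\<forall>x\<in>#M. 0 < psize x) \<and> (\<forall>t. count M (Overlined t) \<le> 1)"

definition reg_mset :: "nat set \<Rightarrow> part multiset" where
  "reg_mset A = image_mset reg (mset_set A)"

lemma count_reg_mset [simp]:
  assumes "finite A"
  shows "count (reg_mset A) (reg n) = (if n \<in> A then 1 else 0)" "count (reg_mset A) (irr n) = 0"
proof -
  have e: "reg_mset A = mset_set (reg ` A)"
    unfolding reg_mset_def by (rule image_mset_mset_set) (simp add: inj_on_def)
  show "count (reg_mset A) (reg n) = (if n \<in> A then 1 else 0)" "count (reg_mset A) (irr n) = 0"
    unfolding e using assms by (auto simp: count_mset_set')
qed

lemma set_reg_mset [simp]: "finite A \<Longrightarrow> set_mset (reg_mset A) = reg ` A"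
  by (simp add: reg_mset_def)

text \<open>Together with \<open>nx_le_irr\<close> this matches the lower ends of the two
  descriptions of a step: parts not above \<open>irr s\<close>, seen from the left, and parts that
  do not hinder the selection of s+2, seen from the right. They differ only in \<open>irr s\<close>
  itself for even \<open>s\<close>, which is overlined and cannot occur twice.\<close>

lemma le_irr_nx: "y \<le> irr s \<Longrightarrow> \<not> (even s \<and> y = irr s) \<Longrightarrow> nx (psize y) \<le> s + 2"
proof -
  assume y: "y \<le> irr s" "\<not> (even s \<and> y = irr s)"
  have "psize y < s \<or> psize y = s \<and> odd s"
    using y by (cases y) (auto simp: less_eq_part_def irr_def split: if_splits)
  then show ?thesis
  proof
    assume "psize y < s"
    then show ?thesis using nx_le[of "psize y"] by linarith
  qed (simp add: nx_odd)
qed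

lemma nx_le_irr: "nx (psize y) \<le> s + 2 \<Longrightarrow> y \<le> irr s"
proof -
  assume y: "nx (psize y) \<le> s + 2"
  then have "psize y \<le> s" using nx_gt[of "psize y"] by linarith
  moreover have "odd s" if "psize y = s" using that y nx_even[of s] by (cases "even s") auto
  ultimately show ?thesis by (auto simp: less_eq_part_def irr_def)
qed

text \<open>Says by covering instead of recursion that \<open>T\<close> is what the selection from
  the left picks when it starts at \<open>irr s\<close>. Its counterpart \<open>right_ok\<close>
  concerns the raised sizes \<open>x + 2\<close> and the selection from the right.\<close>

definition left_ok :: "part multiset \<Rightarrow> nat \<Rightarrow> nat set \<Rightarrow> bool" where
  "left_ok P s T \<longleftrightarrow> (\<forall>y\<in>#P. y \<le> irr s \<or> F_part y \<and> (\<exists>x\<in>T. x \<le> psize y \<and> psize y < nx x))"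

definition right_ok :: "part multiset \<Rightarrow> nat \<Rightarrow> nat set \<Rightarrow> bool" where
  "right_ok P s T \<longleftrightarrow> (\<forall>y\<in>#P. nx (psize y) \<le> s + 2 \<or>
     F_part y \<and> (\<exists>x\<in>T. psize y \<le> x + 2 \<and> x + 2 < nx (psize y)))"

text \<open>
  \<open>P\<close> collects the parts that a raising step leaves alone; \<open>T\<close> is the set of the sizes, before the
  step, of the parts that it moves, and \<open>s = Min T\<close> belongs to the irregular one.
\<close>

definition lowered :: "part multiset \<Rightarrow> nat \<Rightarrow> nat set \<Rightarrow> part multiset" where
  "lowered P s T = P + {#irr s#} + reg_mset (T - {s})"

definition raised :: "part multiset \<Rightarrow> nat set \<Rightarrow> part multiset" where
  "raised P T = P + reg_mset ((\<lambda>x. x + 2) ` T)"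

definition chain_from :: "nat \<Rightarrow> nat set \<Rightarrow> bool" where
  "chain_from s T \<longleftrightarrow> finite T \<and> s \<in> T \<and> (\<forall>x\<in>T. s \<le> x) \<and> 0 < s \<and> spread T"

lemma count_lowered:
  "finite T \<Longrightarrow> count (lowered P s T) (reg n) = count P (reg n) + (if n \<in> T \<and> n \<noteq> s then 1 else 0)"
  "finite T \<Longrightarrow> count (lowered P s T) (irr n) = count P (irr n) + (if n = s then 1 else 0)"
  by (simp_all add: lowered_def)

lemma count_raised:
  assumes "finite T"
  shows "count (raised P T) (reg n) = count P (reg n) + (if 2 \<le> n \<and> n - 2 \<in> T then 1 else 0)"
    "count (raised P T) (irr n) = count P (irr n)"
proof -
  have "n \<in> (\<lambda>x. x + 2) ` T \<longleftrightarrow> 2 \<le> n \<and> n - 2 \<in> T"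
    by (auto intro: image_eqI[of _ _ "n - 2"])
  then show "count (raised P T) (reg n) = count P (reg n) + (if 2 \<le> n \<and> n - 2 \<in> T then 1 else 0)"
    "count (raised P T) (irr n) = count P (irr n)"
    using assms by (simp_all add: raised_def)
qed

lemma op_mset_iff:
  "op_mset M \<longleftrightarrow> (\<forall>x\<in>#M. 0 < psize x) \<and> (\<forall>n. odd n \<longrightarrow> count M (reg n) \<le> 1) \<and> (\<forall>n. even n \<longrightarrow> count M (irr n) \<le> 1)"
  unfolding op_mset_def by (auto simp: reg_def irr_def)

text \<open>For even \<open>x\<close> the conditions \<open>x \<le> n < nx x\<close> and
  \<open>n \<le> x + 2 < nx n\<close> allow the same \<open>n\<close>, namely x, x+1, x+2. For odd
  \<open>x\<close> they allow x, x+1 and x+1, x+2 respectively. The sizes where they differ are odd,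
  and there, apart from \<open>x = s\<close>, a regular part would repeat an overlined part before
  or after the step.\<close>

lemma left_imp_right:
  assumes op: "op_mset (lowered P s T)" and T: "chain_from s T" and L: "left_ok P s T"
  shows "right_ok P s T" "op_mset (raised P T)"
proof -
  have fin: "finite T" using T by (simp add: chain_from_def)
  have spD: "x \<in> T \<Longrightarrow> y \<in> T \<Longrightarrow> x < y \<Longrightarrow> nx x \<le> y" for x y
    using T by (auto simp: chain_from_def spread_def)
  have sT: "s \<in> T" "\<And>x. x \<in> T \<Longrightarrow> s \<le> x" using T by (auto simp: chain_from_def)
  have odd1: "count P (reg n) = 0" if "odd n" "n \<in> T" "n \<noteq> s" for n
  proof -
    have "count (lowered P s T) (reg n) \<le> 1" using op that(1) by (simp add: op_mset_iff)
    then show ?thesis using count_lowered(1)[OF fin, of P s n] that by simp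
  qed
  have even1: "count P (irr s) = 0" if "even s"
  proof -
    have "count (lowered P s T) (irr s) \<le> 1" using op that by (simp add: op_mset_iff)
    then show ?thesis using count_lowered(2)[OF fin, of P s s] by simp
  qed
  show "right_ok P s T"
    unfolding right_ok_def
  proof
    fix y assume y: "y \<in># P"
    show "nx (psize y) \<le> s + 2 \<or> F_part y \<and> (\<exists>x\<in>T. psize y \<le> x + 2 \<and> x + 2 < nx (psize y))"
    proof (cases "y \<le> irr s")
      case True
      have "\<not> (even s \<and> y = irr s)" using even1 y by (auto simp: count_eq_zero_iff)
      then show ?thesis using le_irr_nx[OF True] by blast
    next
      case False
      then obtain x where x: "F_part y" "x \<in> T" "x \<le> psize y" "psize y < nx x"
        using L y unfolding left_ok_def by blast
      have "x + 2 < nx (psize y)"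
      proof (cases "x = psize y")
        case True
        have "even x"
        proof (rule ccontr)
          assume "odd x"
          show False
          proof (cases "x = s")
            case True
            \<comment> \<open>An overlined odd \<open>s\<close> comes before the plain
              \<open>s\<close>, so it is not above \<open>irr s\<close>.\<close>
            then have "y \<le> irr s" using \<open>odd x\<close> \<open>x = psize y\<close> by (simp add: less_eq_part_def irr_def)
            then show False using False by simp
          next
            case False
            then have "count P (reg x) = 0" using odd1 \<open>odd x\<close> x by blast
            then show False using y x(1) True by (simp add: F_part_iff count_eq_zero_iff)
          qed
        qed
        then show ?thesis using True nx_even[of x] by simp
      next
        case False
        then show ?thesis using x(3) nx_gt[of "psize y"] by linarith
      qed
      moreover have "psize y \<le> x + 2" using x(4) nx_le[of x] by linarith
      ultimately show ?thesis using x by blast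
    qed
  qed
  have "count (raised P T) (reg n) \<le> 1" if n: "odd n" for n
  proof (cases "2 \<le> n \<and> n - 2 \<in> T")
    case True
    \<comment> \<open>An untouched overlined \<open>n\<close> could be covered only by
      \<open>n\<close> itself, because the chain jumps from \<open>n - 2\<close> to at least
      \<open>n\<close>. Then \<open>n\<close> would be repeated before the step.\<close>
    have "count P (reg n) = 0"
    proof (rule ccontr)
      assume "count P (reg n) \<noteq> 0"
      then have y: "reg n \<in># P" by (simp add: count_eq_zero_iff)
      have "s < n" using sT(2)[of "n - 2"] True by auto
      then have "\<not> reg n \<le> irr s" by (simp add: less_eq_part_def)
      then obtain x where x: "x \<in> T" "x \<le> n" "n < nx x" using L y unfolding left_ok_def by fastforce
      have nn: "nx (n - 2) = n" using True n nx_odd[of "n - 2"] by auto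
      have "x = n"
      proof -
        have "n - 2 < x" using x(3) nn nx_mono[of x "n - 2"] by linarith
        then have "nx (n - 2) \<le> x" using spD True x by blast
        then show ?thesis using nn x by linarith
      qed
      then show False using odd1[OF n] x(1) \<open>s < n\<close> \<open>count P (reg n) \<noteq> 0\<close> by simp
    qed
    then show ?thesis using count_raised(1)[OF fin, of P n] by simp
  next
    case False
    have "count (lowered P s T) (reg n) \<le> 1" using op n by (simp add: op_mset_iff)
    then show ?thesis
      unfolding count_raised(1)[OF fin] count_lowered(1)[OF fin] if_not_P[OF False] by linarith
  qed
  moreover have "count (raised P T) (irr n) \<le> 1" if "even n" for n
  proof -
    have "count (lowered P s T) (irr n) \<le> 1" using op that by (simp add: op_mset_iff)
    then show ?thesis unfolding count_raised(2)[OF fin] count_lowered(2)[OF fin] by linarith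
  qed
  moreover have "\<forall>x\<in>#raised P T. 0 < psize x"
    using op fin unfolding op_mset_def by (auto simp: raised_def lowered_def)
  ultimately show "op_mset (raised P T)" unfolding op_mset_iff by blast
qed

lemma right_imp_left:
  assumes op: "op_mset (raised P T)" and T: "chain_from s T" and R: "right_ok P s T"
  shows "left_ok P s T" "op_mset (lowered P s T)"
proof -
  have fin: "finite T" using T by (simp add: chain_from_def)
  have spD: "x \<in> T \<Longrightarrow> y \<in> T \<Longrightarrow> x < y \<Longrightarrow> nx x \<le> y" for x y
    using T by (auto simp: chain_from_def spread_def)
  have sT: "s \<in> T" "\<And>x. x \<in> T \<Longrightarrow> s \<le> x" "0 < s" using T by (auto simp: chain_from_def)
  have odd1: "count P (reg (x + 2)) = 0" if "odd x" "x \<in> T" for x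
  proof -
    have "count (raised P T) (reg (x + 2)) \<le> 1" using op that(1) by (simp add: op_mset_iff)
    then show ?thesis using count_raised(1)[OF fin, of P "x + 2"] that by simp
  qed
  show "left_ok P s T"
    unfolding left_ok_def
  proof
    fix y assume y: "y \<in># P"
    show "y \<le> irr s \<or> F_part y \<and> (\<exists>x\<in>T. x \<le> psize y \<and> psize y < nx x)"
    proof (cases "nx (psize y) \<le> s + 2")
      case True
      then show ?thesis using nx_le_irr by blast
    next
      case False
      then obtain x where x: "F_part y" "x \<in> T" "psize y \<le> x + 2" "x + 2 < nx (psize y)"
        using R y unfolding right_ok_def by blast
      have "psize y < nx x"
      proof (cases "psize y = x + 2")
        case True
        have "even x"
        proof (rule ccontr)
          assume "odd x"
          then have "count P (reg (x + 2)) = 0" using odd1 x by blast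
          then show False using y x(1) True by (simp add: F_part_iff count_eq_zero_iff)
        qed
        then show ?thesis using True nx_even[of x] by simp
      next
        case False
        then show ?thesis using x(3) nx_gt[of x] by linarith
      qed
      moreover have "x \<le> psize y" using x(4) nx_le[of "psize y"] by linarith
      ultimately show ?thesis using x by blast
    qed
  qed
  have "count (lowered P s T) (reg n) \<le> 1" if n: "odd n" for n
  proof (cases "n \<in> T \<and> n \<noteq> s")
    case True
    have "count P (reg n) = 0"
    proof (rule ccontr)
      assume "count P (reg n) \<noteq> 0"
      then have y: "reg n \<in># P" by (simp add: count_eq_zero_iff)
      have sn: "s < n" using sT(2)[of n] True by auto
      have nn: "nx n = n + 2" using n by (rule nx_odd)
      then obtain x where x: "x \<in> T" "n \<le> x + 2" "x + 2 < n + 2"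
        using R y sn unfolding right_ok_def by fastforce
      then have "nx x \<le> n" using spD True by auto
      then have "x + 2 = n" using x nx_gt[of x] by linarith
      then show False using odd1[of x] x(1) n \<open>count P (reg n) \<noteq> 0\<close> by auto
    qed
    then show ?thesis using count_lowered(1)[OF fin, of P s n] by simp
  next
    case False
    have "count (raised P T) (reg n) \<le> 1" using op n by (simp add: op_mset_iff)
    then show ?thesis
      unfolding count_raised(1)[OF fin] count_lowered(1)[OF fin] if_not_P[OF False] by linarith
  qed
  moreover have "count (lowered P s T) (irr n) \<le> 1" if "even n" for n
  proof (cases "n = s")
    case True
    have "count P (irr s) = 0"
    proof (rule ccontr)
      assume "count P (irr s) \<noteq> 0"
      then have "irr s \<in># P" by (simp add: count_eq_zero_iff)
      then have "nx s \<le> s + 2" using R unfolding right_ok_def by fastforce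
      then show False using nx_even[of s] that True by simp
    qed
    then show ?thesis using True count_lowered(2)[OF fin, of P s n] by simp
  next
    case False
    have "count (raised P T) (irr n) \<le> 1" using op that by (simp add: op_mset_iff)
    then show ?thesis
      unfolding count_raised(2)[OF fin] count_lowered(2)[OF fin] if_not_P[OF False] by linarith
  qed
  moreover have "\<forall>x\<in>#lowered P s T. 0 < psize x"
    using op fin sT unfolding op_mset_def by (fastforce simp: raised_def lowered_def)
  ultimately show "op_mset (lowered P s T)" unfolding op_mset_iff by blast
qed

text \<open>Without irregular parts the base is the smallest part, so that \<open>idx\<close> below equals \<open>N\<^sub>1\<close>.\<close>

definition is_base :: "part multiset \<Rightarrow> part \<Rightarrow> bool" where
  "is_base M v \<longleftrightarrow> v \<in># M \<and>
     (if \<forall>y\<in>#M. F_part y then \<forall>y\<in>#M. v \<le> y else \<not> F_part v \<and> (\<forall>y\<in>#M. v < y \<longrightarrow> F_part y))"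

text \<open>The size of the base belongs to the tail whether or not the base is regular, so for an
  irregular base the tail lists exactly what a step would move.\<close>

definition is_tail :: "part multiset \<Rightarrow> part \<Rightarrow> nat set \<Rightarrow> bool" where
  "is_tail M v T \<longleftrightarrow> finite T \<and> psize v \<in> T \<and> (\<forall>x\<in>T. psize v \<le> x) \<and> spread T \<and>
     (\<forall>x\<in>T - {psize v}. reg x \<in># M) \<and>
     (\<forall>y\<in>#M. v < y \<longrightarrow> (\<exists>x\<in>T. x \<le> psize y \<and> psize y < nx x))"

lemma is_base_unique: "is_base M v \<Longrightarrow> is_base M w \<Longrightarrow> v = w"
  unfolding is_base_def by (metis antisym_conv3 antisym)

lemma is_base_exists: assumes "M \<noteq> {#}" shows "\<exists>v. is_base M v"
proof (cases "\<forall>y\<in>#M. F_part y")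
  case True
  then have "is_base M (Min (set_mset M))" using assms by (simp add: is_base_def)
  then show ?thesis by blast
next
  case False
  let ?I = "{y \<in> set_mset M. \<not> F_part y}"
  have ne: "?I \<noteq> {}" "finite ?I" using False by auto
  then obtain m where m: "m \<in> ?I" "\<And>y. y \<in> ?I \<Longrightarrow> y \<le> m" using Max_in[OF ne(2,1)] Max_ge[OF ne(2)] by blast
  have above: "F_part y" if y: "y \<in># M" "m < y" for y
  proof (rule ccontr)
    assume "\<not> F_part y"
    then have "y \<le> m" using m(2) y(1) by blast
    then show False using y(2) by simp
  qed
  have "is_base M m" unfolding is_base_def if_not_P[OF False] using m(1) above by blast
  then show ?thesis by blast
qed

lemma base_above: "is_base M v \<Longrightarrow> y \<in># M \<Longrightarrow> v < y \<Longrightarrow> F_part y"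
  unfolding is_base_def by (meson)

lemma is_tail_exists:
  assumes "is_base M v" shows "\<exists>T. is_tail M v T"
proof -
  let ?Y = "{n. reg n \<in># M \<and> psize v < n}"
  have "?Y \<subseteq> psize ` set_mset M" by (metis (mono_tags, lifting) imageI mem_Collect_eq psize_reg subsetI)
  then have "finite ?Y" by (rule finite_subset) simp
  then obtain T where T: "finite T" "psize v \<in> T" "T \<subseteq> insert (psize v) ?Y" "spread T"
      "\<forall>y\<in>?Y. \<exists>x\<in>T. x \<le> y \<and> y < nx x"
    using left_cover_exists[of ?Y "psize v"] by blast
  have "\<exists>x\<in>T. x \<le> psize y \<and> psize y < nx x" if y: "y \<in># M" "v < y" for y
  proof (cases "psize v < psize y")
    case True
    then have "psize y \<in> ?Y" using base_above[OF assms y] y by (auto simp: F_part_iff)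
    then show ?thesis using T(5) by blast
  next
    case False
    then have "psize y = psize v" using y(2) by (auto simp: less_part_def)
    then show ?thesis using T(2) nx_gt[of "psize v"] by (intro bexI[of _ "psize v"]) auto
  qed
  then have "is_tail M v T" using T unfolding is_tail_def by auto
  then show ?thesis by blast
qed

text \<open>Used for lower bounds on \<open>idx\<close>: any spread set of candidate sizes provides
  one.\<close>

lemma tail_max:
  assumes "is_tail M v T" "spread D" "\<And>d. d \<in> D \<Longrightarrow> d = psize v \<or> reg d \<in># M \<and> psize v < d"
  shows "card D \<le> card T"
proof (rule card_le_left_cover[OF _ assms(2)])
  fix d assume "d \<in> D"
  from assms(3)[OF this] show "\<exists>x\<in>T. x \<le> d \<and> d < nx x"
  proof
    assume "d = psize v"
    then show ?thesis using assms(1) nx_gt[of d] unfolding is_tail_def by (intro bexI[of _ d]) auto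
  next
    assume d: "reg d \<in># M \<and> psize v < d"
    then have "v < reg d" by (simp add: less_part_def)
    then show ?thesis using assms(1) d unfolding is_tail_def by fastforce
  qed
qed (use assms(1) in \<open>simp add: is_tail_def\<close>)

lemma tail_elem: "is_tail M v T \<Longrightarrow> d \<in> T \<Longrightarrow> d = psize v \<or> reg d \<in># M \<and> psize v < d"
  unfolding is_tail_def by (metis DiffI le_neq_implies_less singletonD)

text \<open>Upward induction: a member \<open>n\<close> of one chain is covered in the other by some
  \<open>x \<le> n\<close>, and \<open>x < n\<close> would already be common to both and too close
  to \<open>n\<close>.\<close>

lemma is_tail_unique:
  assumes "is_tail M v T" "is_tail M v T'" shows "T = T'"
proof -
  have "n \<in> T \<longleftrightarrow> n \<in> T'" for n
  proof (induction n rule: less_induct)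
    case (less n)
    have *: "n \<in> B" if A: "is_tail M v A" and B: "is_tail M v B" and IH: "\<And>m. m < n \<Longrightarrow> m \<in> B \<Longrightarrow> m \<in> A" and n: "n \<in> A" for A B
    proof (cases "n = psize v")
      case True
      then show ?thesis using B by (simp add: is_tail_def)
    next
      case False
      then have "reg n \<in># M" "v < reg n" using tail_elem[OF A n] by (auto simp: less_part_def)
      then obtain x where x: "x \<in> B" "x \<le> n" "n < nx x" using B unfolding is_tail_def by fastforce
      have "x = n"
      proof (rule ccontr)
        assume "x \<noteq> n"
        then have "x < n" using x by simp
        then have "nx x \<le> n" using IH[of x] x A n unfolding is_tail_def spread_def by blast
        then show False using x by simp
      qed
      then show ?thesis using x by simp
    qed
    show ?case using *[OF assms] *[OF assms(2,1)] less.IH by blast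
  qed
  then show ?thesis by blast
qed

text \<open>The index at which the next step takes place. It is meaningful for nonempty multisets,
  which have a base.\<close>

definition idx :: "part multiset \<Rightarrow> nat" where
  "idx M = (THE j. \<exists>v T. is_base M v \<and> is_tail M v T \<and> card T = j)"

lemma idx_eq: "is_base M v \<Longrightarrow> is_tail M v T \<Longrightarrow> idx M = card T"
  unfolding idx_def by (rule the_equality) (metis is_base_unique is_tail_unique)+

section \<open>One raising step and its inverse\<close>

definition has_first :: "part multiset \<Rightarrow> bool" where
  "has_first M \<longleftrightarrow> (\<exists>w\<in>#M. F_part w \<and> (\<forall>y\<in>#M. w \<le> y))"

text \<open>Only the lower end is required to be legal; for the raised end this follows from
  \<open>left_imp_right\<close> and \<open>shift_has_first\<close>.\<close>

definition shift :: "part multiset \<Rightarrow> nat \<Rightarrow> nat set \<Rightarrow> bool" where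
  "shift P s T \<longleftrightarrow> chain_from s T \<and> left_ok P s T \<and> op_mset (lowered P s T) \<and> has_first (lowered P s T)"

lemma shiftD:
  assumes "shift P s T"
  shows "finite T" "s \<in> T" "\<And>x. x \<in> T \<Longrightarrow> s \<le> x" "0 < s" "spread T" "right_ok P s T" "op_mset (raised P T)"
  using assms left_imp_right[of P s T] by (auto simp: shift_def chain_from_def)

lemma set_lowered: "finite T \<Longrightarrow> y \<in># lowered P s T \<longleftrightarrow> y \<in># P \<or> y = irr s \<or> (\<exists>x\<in>T. x \<noteq> s \<and> y = reg x)"
  by (auto simp: lowered_def)

lemma set_raised: "finite T \<Longrightarrow> y \<in># raised P T \<longleftrightarrow> y \<in># P \<or> (\<exists>x\<in>T. y = reg (x + 2))"
  by (auto simp: raised_def)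

text \<open>The smallest part is regular, hence strictly below \<open>irr s\<close>, and no step
  moves it. This spare part below the moved ones is what lets the index grow.\<close>

lemma shift_first:
  assumes "shift P s T"
  obtains w where "w \<in># P" "F_part w" "w < irr s" "\<And>y. y \<in># raised P T \<Longrightarrow> w \<le> y" "nx (psize w) \<le> s + 2"
proof -
  note D = shiftD[OF assms]
  obtain w where w: "w \<in># lowered P s T" "F_part w" "\<And>y. y \<in># lowered P s T \<Longrightarrow> w \<le> y"
    using assms by (auto simp: shift_def has_first_def)
  have ws: "w < irr s" using w(2) w(3)[of "irr s"] set_lowered[OF D(1)] by (auto simp: order.order_iff_strict)
  have "\<not> (\<exists>x\<in>T. x \<noteq> s \<and> w = reg x)"
  proof
    assume "\<exists>x\<in>T. x \<noteq> s \<and> w = reg x"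
    then obtain x where "x \<in> T" "x \<noteq> s" "w = reg x" by blast
    then have "s < psize w" using D(3)[of x] by simp
    then show False using ws by (auto simp: less_part_def)
  qed
  then have wP: "w \<in># P" using w(1) set_lowered[OF D(1)] w(2) by auto
  have nx: "nx (psize w) \<le> s + 2" using le_irr_nx[OF less_imp_le[OF ws]] ws by blast
  have min: "w \<le> y" if y: "y \<in># raised P T" for y
  proof (cases "y \<in># P")
    case True
    then show ?thesis using w(3) set_lowered[OF D(1), of y P s] by blast
  next
    case False
    then obtain x where "x \<in> T" "y = reg (x + 2)" using y set_raised[OF D(1), of y P] by blast
    then have "psize w < psize y" using D(3)[of x] ws by (auto simp: less_part_def)
    then show ?thesis by (simp add: less_eq_part_def)
  qed
  show thesis by (rule that[OF wP w(2) ws min nx])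
qed

lemma shift_has_first:
  assumes "shift P s T" shows "has_first (raised P T)"
proof (rule shift_first[OF assms])
  fix w assume "w \<in># P" "F_part w" "\<And>y. y \<in># raised P T \<Longrightarrow> w \<le> y"
  moreover from this have "w \<in># raised P T" by (simp add: raised_def)
  ultimately show ?thesis unfolding has_first_def by blast
qed

lemma shift_idx_lowered:
  assumes "shift P s T"
  shows "is_base (lowered P s T) (irr s)" "is_tail (lowered P s T) (irr s) T"
proof -
  note D = shiftD[OF assms] and S = set_lowered[OF shiftD(1)[OF assms]]
  have L: "left_ok P s T" using assms by (simp add: shift_def)
  have "F_part y" if "y \<in># lowered P s T" "irr s < y" for y
    using that S[of y] L unfolding left_ok_def by (auto dest: leD)
  then show "is_base (lowered P s T) (irr s)"
    unfolding is_base_def using S[of "irr s" P s] F_part_irr by auto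
  have "\<exists>x\<in>T. x \<le> psize y \<and> psize y < nx x" if y: "y \<in># lowered P s T" "irr s < y" for y
  proof -
    consider "y \<in># P" | x where "x \<in> T" "y = reg x" using y S[of y] by auto
    then show ?thesis
    proof cases
      case 1
      then show ?thesis using L y(2) unfolding left_ok_def by (auto dest: leD)
    next
      case 2
      then show ?thesis using nx_gt[of x] by (intro bexI[of _ x]) auto
    qed
  qed
  then show "is_tail (lowered P s T) (irr s) T" using D S unfolding is_tail_def by auto
qed

text \<open>The size of the new base can be put in front of the raised sizes. This gives a spread
  set with one element more than \<open>T\<close>, and the tail of the new base is at least as
  long.\<close>

lemma shift_idx_raised:
  assumes "shift P s T"
  shows "card T < idx (raised P T)"
proof -
  note D = shiftD[OF assms] and S = set_raised[OF shiftD(1)[OF assms]]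
  obtain w where w: "w \<in># P" "F_part w" "w < irr s" "\<And>y. y \<in># raised P T \<Longrightarrow> w \<le> y" "nx (psize w) \<le> s + 2"
    using shift_first[OF assms] by blast
  have "raised P T \<noteq> {#}" using w(1) by (auto simp: raised_def)
  then obtain v T' where v: "is_base (raised P T) v" and T': "is_tail (raised P T) v T'"
    using is_base_exists is_tail_exists by blast
  \<comment> \<open>A regular base is the smallest part. An irregular one is not a raised part, so
    \<open>right_ok\<close> leaves only the low position for it.\<close>
  have nv: "nx (psize v) \<le> s + 2"
  proof (cases "F_part v")
    case True
    then have "\<forall>y\<in>#raised P T. v \<le> y" using v unfolding is_base_def by (metis (full_types))
    then have "v \<le> w" using w(1) by (auto simp: raised_def)
    then have "psize v \<le> psize w" by (auto simp: less_eq_part_def)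
    then show ?thesis using nx_mono w(5) le_trans by blast
  next
    case False
    have "v \<in># raised P T" using v unfolding is_base_def by blast
    then have "v \<in># P" using S[of v P] False F_part_reg by blast
    then show ?thesis using D(6) False unfolding right_ok_def by blast
  qed
  let ?D = "insert (psize v) ((\<lambda>x. x + 2) ` T)"
  have gt: "psize v < x + 2" if "x \<in> T" for x using nv nx_gt[of "psize v"] D(3)[OF that] by linarith
  have "spread ?D"
  proof (rule spread_insert)
    show "spread ((\<lambda>x. x + 2) ` T)" using D(5) spread_add2 by blast
    fix y assume "y \<in> (\<lambda>x. x + 2) ` T"
    then have "s + 2 \<le> y" using D(3) by auto
    then show "nx (psize v) \<le> y" using nv by linarith
  qed
  then have "card ?D \<le> card T'"
    by (rule tail_max[OF T']) (use S gt in auto)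
  moreover have "psize v \<notin> (\<lambda>x. x + 2) ` T" using gt by force
  moreover have "card ((\<lambda>x. x + 2) ` T) = card T" by (rule card_image) (simp add: inj_on_def)
  ultimately have "card T < card T'" using D(1) by simp
  then show ?thesis using idx_eq[OF v T'] by simp
qed

lemma shift_exists_raise:
  assumes op: "op_mset M" "has_first M" and v: "is_base M v" "\<not> F_part v"
  shows "\<exists>P T. shift P (psize v) T \<and> M = lowered P (psize v) T \<and> card T = idx M"
proof -
  let ?s = "psize v"
  obtain T where T: "is_tail M v T" using is_tail_exists[OF v(1)] by blast
  have fin: "finite T" using T by (simp add: is_tail_def)
  have vi: "v = irr ?s" using v(2) by (simp add: not_F_part_iff)
  let ?R = "{#irr ?s#} + reg_mset (T - {?s})"
  define P where "P = M - ?R"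
  have "?R \<subseteq># M"
  proof (rule mset_subset_eqI)
    fix a
    have "v \<in># M" "\<forall>x\<in>T - {?s}. reg x \<in># M" using v(1) T by (auto simp: is_base_def is_tail_def)
    moreover have "count ?R (reg (psize a)) = (if psize a \<in> T - {?s} then 1 else 0)"
      "count ?R (irr (psize a)) = (if psize a = ?s then 1 else 0)" using fin by simp_all
    ultimately have "count ?R (reg (psize a)) \<le> count M (reg (psize a))" "count ?R (irr (psize a)) \<le> count M (irr (psize a))"
      using vi by (auto simp: Suc_le_eq simp del: psize_irr)
    then show "count ?R a \<le> count M a" by (metis reg_irr_cases)
  qed
  then have "P + ?R = M" unfolding P_def by (rule subset_mset.diff_add)
  then have M: "M = lowered P ?s T" unfolding lowered_def add.assoc by (rule sym)
  have "left_ok P ?s T"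
    unfolding left_ok_def
  proof
    fix y assume "y \<in># P"
    then have y: "y \<in># M" by (simp add: P_def in_diffD)
    show "y \<le> irr ?s \<or> F_part y \<and> (\<exists>x\<in>T. x \<le> psize y \<and> psize y < nx x)"
    proof (cases "v < y")
      case True
      then show ?thesis using base_above[OF v(1) y] T y unfolding is_tail_def by blast
    next
      case False
      then show ?thesis using vi by (simp add: vi[symmetric] not_less)
    qed
  qed
  moreover have "0 < ?s" using op v(1) by (auto simp: op_mset_def is_base_def)
  ultimately have "shift P ?s T" using T op M by (auto simp: shift_def chain_from_def is_tail_def)
  then show ?thesis using M idx_eq[OF v(1) T] by metis
qed

text \<open>The parts to move down are the first \<open>j\<close> picks of the selection from the
  right among the sizes that may follow the base. There are enough picks because the current tail
  without its base is a spread set of such sizes, and the greedy set \<open>C\<close> is at least as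
  large.\<close>

lemma shift_exists_lower:
  assumes op: "op_mset M" "has_first M" and j: "1 \<le> j" "j < idx M"
  shows "\<exists>P s T. shift P s T \<and> M = raised P T \<and> card T = j"
proof -
  obtain w where w: "w \<in># M" "F_part w" "\<And>y. y \<in># M \<Longrightarrow> w \<le> y"
    using op(2) unfolding has_first_def by blast
  have "M \<noteq> {#}" using w(1) by auto
  then obtain v T' where v: "is_base M v" and T': "is_tail M v T'"
    using is_base_exists is_tail_exists by blast
  have vM: "v \<in># M" using v unfolding is_base_def by blast
  have jT: "j < card T'" using j(2) idx_eq[OF v T'] by simp
  \<comment> \<open>The bound \<open>nx (psize v)\<close> ensures that the lowest moved part,
    lowered to \<open>irr s\<close>, still lies at or above the base and so becomes the last
    irregular part.\<close>
  define Z where "Z = {z. reg z \<in># M \<and> nx (psize v) \<le> z}"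
  have "Z \<subseteq> psize ` set_mset M"
    unfolding Z_def by (metis (mono_tags, lifting) imageI mem_Collect_eq psize_reg subsetI)
  then have finZ: "finite Z" by (rule finite_subset) simp
  obtain C where C: "C \<subseteq> Z" "spread C" "\<forall>y\<in>Z. \<exists>z\<in>C. y \<le> z \<and> z < nx y"
    using right_cover_exists[OF finZ] by blast
  have finC: "finite C" using finite_subset[OF C(1) finZ] .
  have sub: "T' - {psize v} \<subseteq> Z"
  proof
    fix x assume x: "x \<in> T' - {psize v}"
    then have "reg x \<in># M" "psize v < x" using tail_elem[OF T', of x] by auto
    moreover have "nx (psize v) \<le> x"
      using T' x \<open>psize v < x\<close> unfolding is_tail_def spread_def by blast
    ultimately show "x \<in> Z" by (simp add: Z_def)
  qed
  have "card (T' - {psize v}) \<le> card C"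
  proof (rule card_le_right_cover[OF finC])
    show "spread (T' - {psize v})" by (rule spread_subset[of T']) (use T' in \<open>auto simp: is_tail_def\<close>)
  qed (use C(3) sub in blast)
  moreover have "card (T' - {psize v}) = card T' - 1" using T' by (simp add: is_tail_def)
  ultimately have "j \<le> card C" using jT by linarith
  then obtain D where D: "D \<subseteq> C" "card D = j" "\<forall>x\<in>D. \<forall>y\<in>C - D. y < x"
    using top_elements[OF finC] by blast
  have finD: "finite D" using finite_subset[OF D(1) finC] .
  have Dne: "D \<noteq> {}" using D(2) j(1) by auto
  define d where "d = Min D"
  have d: "d \<in> D" "\<And>x. x \<in> D \<Longrightarrow> d \<le> x" using finD Dne by (simp_all add: d_def)
  have DZ: "reg x \<in># M" "nx (psize v) \<le> x" if "x \<in> D" for x using that D(1) C(1) unfolding Z_def by blast+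
  have D3: "3 \<le> x" if "x \<in> D" for x using DZ(2)[OF that] by (simp add: nx_def)
  define T where "T = (\<lambda>x. x - 2) ` D"
  define s where "s = d - 2"
  have TD: "(\<lambda>x. x + 2) ` T = D"
  proof -
    have "(\<lambda>x. x + 2) ` T = (\<lambda>x. x) ` D"
      unfolding T_def image_image by (rule image_cong[OF refl]) (use D3 in fastforce)
    then show ?thesis by simp
  qed
  have s2: "s + 2 = d" using D3[OF d(1)] by (simp add: s_def)
  have cardT: "card T = j"
  proof -
    have "card ((\<lambda>x. x + 2) ` T) = card T" by (rule card_image) (simp add: inj_on_def)
    then show ?thesis using TD D(2) by simp
  qed
  have finT: "finite T" using finD by (simp add: T_def)
  have chain: "chain_from s T"
    unfolding chain_from_def
  proof (intro conjI ballI)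
    show "finite T" by (rule finT)
    show "s \<in> T" using d(1) by (auto simp: T_def s_def)
    show "s \<le> x" if "x \<in> T" for x using that d(2) by (auto simp: T_def s_def intro: diff_le_mono)
    show "0 < s" using D3[OF d(1)] by (simp add: s_def)
    have "spread ((\<lambda>x. x + 2) ` T)" unfolding TD by (rule spread_subset[OF C(2) D(1)])
    then show "spread T" by (simp only: spread_add2)
  qed
  define P where "P = M - reg_mset D"
  have "reg_mset D \<subseteq># M"
  proof (rule mset_subset_eqI)
    fix a
    show "count (reg_mset D) a \<le> count M a"
    proof (rule reg_irr_cases[of a])
      assume "a = reg (psize a)"
      then have "count (reg_mset D) a = (if psize a \<in> D then 1 else 0)"
        using count_reg_mset(1)[OF finD, of "psize a"] by simp
      moreover have "1 \<le> count M a" if "psize a \<in> D"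
        using DZ(1)[OF that] \<open>a = reg (psize a)\<close> by (simp add: Suc_le_eq)
      ultimately show ?thesis by auto
    next
      assume "a = irr (psize a)"
      then show ?thesis using count_reg_mset(2)[OF finD, of "psize a"] by simp
    qed
  qed
  then have "P + reg_mset D = M" unfolding P_def by (rule subset_mset.diff_add)
  then have M: "M = raised P T" unfolding raised_def TD by (rule sym)
  have PM: "y \<in># M" if "y \<in># P" for y using that by (simp add: P_def in_diffD)
  have inP: "y \<in># P" if "y \<in># M" "\<not> (\<exists>x\<in>D. y = reg x)" for y
    using that unfolding M set_raised[OF finT] using TD by (metis imageI)
  have vP: "v \<in># P"
  proof (rule inP[OF vM])
    show "\<not> (\<exists>x\<in>D. v = reg x)" using DZ(2) nx_gt[of "psize v"] by fastforce
  qed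
  have wP: "w \<in># P"
  proof (rule inP[OF w(1)])
    have "psize w \<le> psize v" using w(3)[OF vM] by (auto simp: less_eq_part_def)
    then show "\<not> (\<exists>x\<in>D. w = reg x)" using DZ(2) nx_gt[of "psize v"] by fastforce
  qed
  have vd: "nx (psize v) \<le> s + 2" using DZ(2)[OF d(1)] s2 by simp
  have R: "right_ok P s T"
    unfolding right_ok_def
  proof
    fix y assume "y \<in># P"
    then have y: "y \<in># M" by (rule PM)
    show "nx (psize y) \<le> s + 2 \<or> F_part y \<and> (\<exists>x\<in>T. psize y \<le> x + 2 \<and> x + 2 < nx (psize y))"
    proof (cases "psize y \<le> psize v \<or> nx (psize y) \<le> s + 2")
      case True
      then show ?thesis using vd nx_mono le_trans by blast
    next
      case False
      then have "v < y" by (simp add: less_part_def)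
      then have F: "F_part y" using base_above[OF v y] by blast
      have "\<exists>z\<in>D. psize y \<le> z \<and> z < nx (psize y)"
      proof (cases "psize y \<le> d")
        case True
        then show ?thesis using d(1) False s2 by (intro bexI[of _ d]) auto
      next
        case ge: False
        then have "psize y \<in> Z" using DZ(2)[OF d(1)] y F by (simp add: Z_def F_part_iff)
        then obtain z where z: "z \<in> C" "psize y \<le> z" "z < nx (psize y)" using C(3) by blast
        \<comment> \<open>\<open>D\<close> is the top segment of \<open>C\<close>, so the picks left
          out are below \<open>d\<close>.\<close>
        have "z \<in> D"
        proof (rule ccontr)
          assume "z \<notin> D"
          then have "z < d" using D(3) d(1) z(1) by blast
          then show False using z(2) ge by linarith
        qed
        then show ?thesis using z by blast
      qed
      then show ?thesis using F unfolding TD[symmetric] by blast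
    qed
  qed
  note L = right_imp_left[OF op(1)[unfolded M] chain R]
  have min: "w \<le> y" if y: "y \<in># lowered P s T" for y
  proof -
    have ws: "w \<le> irr s" using w(3)[OF vM] nx_le_irr[OF vd] by (rule order_trans)
    consider "y \<in># P" | "y = irr s" | x where "x \<in> T" "x \<noteq> s" "y = reg x"
      using y set_lowered[OF finT, of y P s] by blast
    then show ?thesis
    proof cases
      case 1
      then show ?thesis using w(3) PM by blast
    next
      case 2
      then show ?thesis using ws by simp
    next
      case 3
      then have "s < psize y" using chain by (auto simp: chain_from_def order.not_eq_order_implies_strict)
      then show ?thesis using ws by (auto simp: less_eq_part_def)
    qed
  qed
  have "w \<in># lowered P s T" using wP by (simp add: lowered_def)
  then have "has_first (lowered P s T)" using w(2) min unfolding has_first_def by blast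
  then have "shift P s T" using chain L by (simp add: shift_def)
  then show ?thesis using M cardT by blast
qed

text \<open>\<open>s\<close> and \<open>T\<close> can be read off the lowered multiset as its base
  and its tail.\<close>

lemma shift_raise_unique:
  assumes "shift P s T" "shift P' s' T'" "lowered P s T = lowered P' s' T'"
  shows "raised P T = raised P' T'"
proof -
  have s: "s = s'"
    using is_base_unique[OF shift_idx_lowered(1)[OF assms(1)]] shift_idx_lowered(1)[OF assms(2)] assms(3)
    by (metis irr_inj)
  then have T: "T = T'"
    using is_tail_unique[OF shift_idx_lowered(2)[OF assms(1)]] shift_idx_lowered(2)[OF assms(2)] assms(3)
    by metis
  have "P = P'" using assms(3) unfolding lowered_def s T by simp
  then show ?thesis using T by simp
qed

lemma raised_cover:
  assumes "shift P s T" "y \<in># raised P T" "s + 2 < psize y"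
  shows "\<exists>x\<in>T. psize y \<le> x + 2 \<and> x + 2 < nx (psize y)"
proof (cases "y \<in># P")
  case True
  have "\<not> nx (psize y) \<le> s + 2" using assms(3) nx_gt[of "psize y"] by linarith
  then show ?thesis using shiftD(6)[OF assms(1)] True unfolding right_ok_def by blast
next
  case False
  then obtain x where x: "x \<in> T" "y = reg (x + 2)"
    using assms(2) set_raised[OF shiftD(1)[OF assms(1)], of y P] by blast
  then show ?thesis using nx_gt[of "x + 2"] by (intro bexI[of _ x]) auto
qed

lemma raised_mem: "shift P s T \<Longrightarrow> x \<in> T \<Longrightarrow> reg (x + 2) \<in># raised P T"
  using set_raised[OF shiftD(1)] by blast

text \<open>One step of a downward comparison: the element of \<open>T'\<close> that covers
  \<open>n + 2\<close> from the right must come from \<open>n\<close>, since a larger one would lie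
  in \<open>T\<close> as well, too close to \<open>n\<close>.\<close>

lemma shift_tail_step:
  assumes A: "shift P s T" and B: "shift P' s' T'" and eq: "raised P T = raised P' T'"
    and n: "n \<in> T" "s' \<le> n" and IH: "\<And>m. n < m \<Longrightarrow> m \<in> T' \<Longrightarrow> m \<in> T"
  shows "n \<in> T'"
proof (cases "n = s'")
  case True
  then show ?thesis using shiftD(2)[OF B] by simp
next
  case False
  have "reg (n + 2) \<in># raised P' T'" using raised_mem[OF A n(1)] eq by simp
  from raised_cover[OF B this] obtain x where x: "x \<in> T'" "n \<le> x" "x + 2 < nx (n + 2)"
    using False n(2) by auto
  have "x = n"
  proof (rule ccontr)
    assume "x \<noteq> n"
    then have "n < x" using x(2) by simp
    then have "nx n \<le> x" using IH[OF _ x(1)] n(1) shiftD(5)[OF A] unfolding spread_def by blast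
    then show False using x(3) by (simp add: nx_add2[simplified])
  qed
  then show ?thesis using x(1) by simp
qed

text \<open>The raised multiset fixes the picks from the top downwards but does not show where the
  chain stops. Hence only an inclusion here; equality is left to the cardinality.\<close>

lemma shift_lower_subset:
  assumes A: "shift P s T" and B: "shift P' s' T'" and eq: "raised P T = raised P' T'" and le: "s' \<le> s"
  shows "T \<subseteq> T'"
proof -
  define D where "D = {n \<in> T \<union> T'. s \<le> n \<and> (n \<in> T) \<noteq> (n \<in> T')}"
  have fin: "finite D" using shiftD(1)[OF A] shiftD(1)[OF B] by (simp add: D_def)
  have "D = {}"
  proof (rule ccontr)
    assume "D \<noteq> {}"
    then obtain n where n: "n \<in> D" "\<And>m. m \<in> D \<Longrightarrow> m \<le> n"
      using Max_in[OF fin] Max_ge[OF fin] by blast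
    have agree: "m \<in> T \<longleftrightarrow> m \<in> T'" if "n < m" for m
    proof (rule ccontr)
      assume "(m \<in> T) \<noteq> (m \<in> T')"
      then have "m \<in> D" using that n(1) by (auto simp: D_def)
      then show False using n(2) that leD by blast
    qed
    have sn: "s \<le> n" "s' \<le> n" using n(1) le by (auto simp: D_def)
    have "n \<in> T \<Longrightarrow> n \<in> T'"
      by (rule shift_tail_step[OF A B eq _ sn(2)]) (use agree in auto)
    moreover have "n \<in> T' \<Longrightarrow> n \<in> T"
      by (rule shift_tail_step[OF B A eq[symmetric] _ sn(1)]) (use agree in auto)
    ultimately show False using n(1) by (auto simp: D_def)
  qed
  then show ?thesis using shiftD(3)[OF A] by (auto simp: D_def)
qed

lemma shift_lower_unique:
  assumes A: "shift P s T" and B: "shift P' s' T'" and eq: "raised P T = raised P' T'" and c: "card T = card T'"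
  shows "lowered P s T = lowered P' s' T'"
proof -
  have T: "T = T'"
  proof (cases "s' \<le> s")
    case True
    then show ?thesis
      using card_subset_eq[OF shiftD(1)[OF B] shift_lower_subset[OF A B eq True]] c by simp
  next
    case False
    then have "s \<le> s'" by simp
    from shift_lower_subset[OF B A eq[symmetric] this] show ?thesis
      using card_subset_eq[OF shiftD(1)[OF A], of T'] c by simp
  qed
  then have "s = s'" using shiftD(2,3)[OF A] shiftD(2,3)[OF B] by (simp add: antisym)
  moreover have "P = P'" using eq unfolding raised_def T by simp
  ultimately show ?thesis using T by simp
qed

section \<open>What a raising step changes and what it preserves\<close>

lemma sum_reg_mset: "(\<Sum>x\<in>#reg_mset A. psize x) = \<Sum>A"
  by (simp add: reg_mset_def image_mset.compositionality comp_def sum_unfold_sum_mset)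

lemma shift_weight:
  assumes "shift P s T"
  shows "(\<Sum>x\<in>#raised P T. psize x) = (\<Sum>x\<in>#lowered P s T. psize x) + 2 * card T"
proof -
  note D = shiftD[OF assms]
  have "\<Sum>((\<lambda>x. x + 2) ` T) = \<Sum>T + 2 * card T"
    by (subst sum.reindex) (simp_all add: inj_on_def comp_def sum.distrib del: add_2_eq_Suc')
  moreover have "\<Sum>T = s + \<Sum>(T - {s})" using sum.remove[OF D(1,2), of id] by simp
  ultimately show ?thesis by (simp add: raised_def lowered_def sum_reg_mset)
qed

lemma shift_size:
  assumes "shift P s T" shows "size (raised P T) = size (lowered P s T)"
proof -
  note D = shiftD[OF assms]
  have "card ((\<lambda>x. x + 2) ` T) = card T" by (rule card_image) (simp add: inj_on_def)
  moreover have "card T = Suc (card (T - {s}))" using card.remove[OF D(1,2)] .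
  ultimately show ?thesis by (simp add: raised_def lowered_def reg_mset_def)
qed

text \<open>Condition (1) sees only the sizes 1 and 2, while raised parts have size at least 3 and a
  moved regular part has size at least \<open>nx 1 = 3\<close> even before the step.\<close>

lemma shift_small_parts:
  assumes "shift P s T"
  shows "count (raised P T) (Overlined 1) = count (lowered P s T) (Overlined 1)"
    "count (raised P T) (Plain 2) = count (lowered P s T) (Plain 2)"
proof -
  note D = shiftD[OF assms]
  have n: "\<not> (1 \<in> T \<and> 1 \<noteq> s)" "0 \<notin> T" using D(3,4) by fastforce+
  have "\<not> (2 \<in> T \<and> 2 \<noteq> s)"
  proof
    assume 2: "2 \<in> T \<and> 2 \<noteq> s"
    then have "s = 1" using D(3)[of 2] D(4) by auto
    then have "nx 1 \<le> 2" using D(2,5) 2 unfolding spread_def by auto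
    then show False by (simp add: nx_def)
  qed
  then show "count (raised P T) (Overlined 1) = count (lowered P s T) (Overlined 1)"
    "count (raised P T) (Plain 2) = count (lowered P s T) (Plain 2)"
    using n count_raised(1)[OF D(1), of P 1] count_lowered(1)[OF D(1), of P s 1]
      count_raised(1)[OF D(1), of P 2] count_lowered(1)[OF D(1), of P s 2]
    by (simp_all add: reg_def)
qed

text \<open>Provides the decreasing measure for the induction in
  \<open>idx_le_first\<close>.\<close>

lemma shift_irregular:
  assumes "shift P s T"
  shows "size {#x \<in># lowered P s T. \<not> F_part x#} = Suc (size {#x \<in># raised P T. \<not> F_part x#})"
proof -
  have e: "{#x \<in># reg_mset A. \<not> F_part x#} = {#}" if "finite A" for A
  proof (rule multiset_eqI)
    fix x show "count {#x \<in># reg_mset A. \<not> F_part x#} x = count {#} x"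
      using set_reg_mset[OF that] by (auto simp: count_eq_zero_iff)
  qed
  show ?thesis using shiftD(1)[OF assms] by (simp add: lowered_def raised_def e)
qed

lemma shift_kept:
  assumes "shift P s T" "1 \<le> r" "\<And>x. x \<in> T \<Longrightarrow> x \<le> 2*u"
  shows "(\<Sum>u<Suc u. kept r (count (lowered P s T)) u) = (\<Sum>u<Suc u. kept r (count (raised P T)) u)"
proof -
  note D = shiftD[OF assms(1)]
  have "left_ok P s T" "op_mset (lowered P s T)" using assms(1) by (simp_all add: shift_def)
  then interpret raise "count P" s T "count (lowered P s T)" "count (raised P T)"
    by unfold_locales
      (use D count_lowered[OF D(1)] count_raised[OF D(1)] in \<open>auto simp: left_ok_def op_mset_def\<close>)
  show ?thesis by (rule kept_raise_eq[OF assms(2,3)])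
qed

section \<open>The bijection\<close>

lemma overpartition_iff: "overpartition l \<longleftrightarrow> sorted l \<and> op_mset (mset l)"
  by (simp add: overpartition_def op_mset_def count_mset)

lemma has_first_iff: "sorted l \<Longrightarrow> has_first (mset l) \<longleftrightarrow> l \<noteq> [] \<and> F_part (hd l)"
proof (cases l)
  case (Cons a l')
  assume "sorted l"
  then have "\<forall>y\<in>set l. a \<le> y" using Cons by auto
  then show ?thesis using Cons unfolding has_first_def by (auto intro: antisym)
qed (simp add: has_first_def)

lemma mset_sum: "(\<Sum>x\<in>#mset l. psize x) = weight l"
  by (metis mset_map sum_mset_sum_list weight_def)

lemma shift_marked:
  assumes sh: "shift P s T" and l: "sorted l" "mset l = lowered P s T" and l': "sorted l'" "mset l' = raised P T"
  shows "length (filter (\<lambda>m. m \<le> r) (GG_marking l)) = length (filter (\<lambda>m. m \<le> r) (GG_marking l'))"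
proof -
  have op: "overpartition l" "overpartition l'"
    using sh shiftD(7)[OF sh] l l' by (simp_all add: overpartition_iff shift_def)
  obtain u where u: "\<forall>n \<in> psize ` set l \<union> psize ` set l' \<union> T. n \<le> u"
    using finite_nat_set_iff_bounded_le[of "psize ` set l \<union> psize ` set l' \<union> T"] shiftD(1)[OF sh] by auto
  have u': "x \<in> set l \<Longrightarrow> psize x \<le> u" "x \<in> set l' \<Longrightarrow> psize x \<le> u" "n \<in> T \<Longrightarrow> n \<le> u" for x n
    using u by blast+
  have b: "\<forall>x\<in>set l. psize x \<le> 2 * Suc u" "\<forall>x\<in>set l'. psize x \<le> 2 * Suc u"
    by (auto dest: u')
  have c: "count_list l = count (lowered P s T)" "count_list l' = count (raised P T)"
    unfolding l(2)[symmetric] l'(2)[symmetric] by (simp_all add: fun_eq_iff count_mset)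
  show ?thesis
  proof (cases "r = 0")
    case False
    then have "(\<Sum>u<Suc u. kept r (count (lowered P s T)) u) = (\<Sum>u<Suc u. kept r (count (raised P T)) u)"
      by (intro shift_kept[OF sh]) (auto dest: u'(3))
    then show ?thesis unfolding marked_total[OF op(1) b(1)] marked_total[OF op(2) b(2)] c by simp
  qed (unfold marked_total[OF op(1) b(1)] marked_total[OF op(2) b(2)], simp)
qed

lemma marking_count_eq:
  fixes r :: nat
  assumes "\<And>r. length (filter (\<lambda>m. m \<le> r) ms) = length (filter (\<lambda>m. m \<le> r) ms')" "1 \<le> r"
  shows "count_list ms r = count_list ms' r"
  using assms(1)[of r] assms(1)[of "r - 1"] length_filter_Suc[of "r - 1" ms] length_filter_Suc[of "r - 1" ms'] assms(2)
  by simp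

text \<open>If no mark exceeds \<open>r\<close>, every multiplicity equals its kept value, and the
  caps built into the greedy formulas are conditions (2) and (3) for k = r+1.\<close>

lemma marks_le_conditions:
  assumes l: "overpartition l" and r: "1 \<le> r" and marks: "\<And>j. j < length l \<Longrightarrow> mark l j \<le> r"
  shows "count_list l (Overlined (2*t)) + count_list l (Plain (2*t)) + count_list l (Overlined (2*t+1)) +
      count_list l (Plain (2*t+2)) \<le> r"
    and "1 \<le> count_list l (Plain (2*t+1)) \<Longrightarrow> count_list l (Plain (2*t+2)) + 1 \<le> r"
proof -
  let ?f = "count_list l"
  have all: "card {j. j < length l \<and> l ! j = x \<and> mark l j \<le> r} = ?f x" for x
  proof -
    have "{j. j < length l \<and> l ! j = x \<and> mark l j \<le> r} = {j. j < length l \<and> l ! j = x}" using marks by auto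
    then show ?thesis by (simp add: card_index)
  qed
  have a: "?f (Overlined (2*u+1)) = kept_overlined r ?f u" for u
    using column_overlined(1)[OF l _ _ r, of u] marks_even[OF l, of u] all by auto
  have b: "?f (Plain (2*u+2)) = kept_plain r ?f u" for u
    using column_even(1)[OF l _ _ r, of u] marks_even[OF l, of u] all by auto
  have c: "kept_even r ?f t = ?f (Overlined (2*t)) + ?f (Plain (2*t))"
  proof (cases t)
    case 0
    have "Overlined 0 \<notin> set l" "Plain 0 \<notin> set l" using l by (auto simp: overpartition_def)
    then show ?thesis using 0 by (simp add: count_list_0_iff)
  next
    case (Suc u)
    then have "2 * t = 2*u+2" by simp
    then show ?thesis unfolding Suc kept_even_Suc using b[of u] by simp
  qed
  have "kept_even r ?f t \<le> r"
    by (rule kept_even_le[OF r]) (use l in \<open>simp add: overpartition_def\<close>)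
  then show "?f (Overlined (2*t)) + ?f (Plain (2*t)) + ?f (Overlined (2*t+1)) + ?f (Plain (2*t+2)) \<le> r"
    using a[of t] b[of t] c unfolding kept_plain_def kept_overlined_def by linarith
  show "?f (Plain (2*t+2)) + 1 \<le> r" if "1 \<le> ?f (Plain (2*t+1))"
    using b[of t] that r unfolding kept_plain_def by auto
qed

lemma F_marked_iff:
  assumes k: "2 \<le> k"
  shows "l \<in> F_marked k N i \<longleftrightarrow> overpartition l \<and> length l = (\<Sum>r = 1..k - 1. N r) \<and>
    (l \<noteq> [] \<longrightarrow> F_part (hd l)) \<and> count_list l (Overlined 1) + count_list l (Plain 2) + 1 \<le> i \<and>
    (\<forall>r\<in>{1..k - 1}. count_list (GG_marking l) r = N r)" (is "_ \<longleftrightarrow> ?R")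
proof
  assume R: ?R
  have "length (filter (\<lambda>m. m \<le> r) (GG_marking l)) = (\<Sum>s = 1..r. count_list (GG_marking l) s)" for r
  proof (induction r)
    case 0
    show ?case using mark_pos[of l] unfolding length_filter_marking by simp
  next
    case (Suc r)
    then show ?case unfolding length_filter_Suc by simp
  qed
  \<comment> \<open>The prescribed counts add up to the number of parts, so no mark exceeds
    \<open>k - 1\<close>.\<close>
  then have "length (filter (\<lambda>m. m \<le> k - 1) (GG_marking l)) = length l" using R by simp
  then have c: "card {j. j < length l \<and> mark l j \<le> k - 1} = length l" by (simp add: length_filter_marking)
  have "{j. j < length l \<and> mark l j \<le> k - 1} = {..<length l}"
    by (rule card_subset_eq) (use c in auto)
  then have marks: "j < length l \<Longrightarrow> mark l j \<le> k - 1" for j by blast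
  have op: "overpartition l" and r: "1 \<le> k - 1" using R k by auto
  note m = marks_le_conditions[OF op r marks]
  have "\<forall>t. count_list l (Overlined (2*t)) + count_list l (Plain (2*t))
              + count_list l (Overlined (2*t + 1)) + count_list l (Plain (2*t + 2)) + 1 \<le> k"
  proof
    fix t show "count_list l (Overlined (2*t)) + count_list l (Plain (2*t))
              + count_list l (Overlined (2*t + 1)) + count_list l (Plain (2*t + 2)) + 1 \<le> k"
      using m(1)[OF _, of t] k by simp
  qed
  moreover have "\<forall>t. 1 \<le> count_list l (Plain (2*t + 1)) \<longrightarrow> count_list l (Plain (2*t + 2)) + 2 \<le> k"
  proof (intro allI impI)
    fix t assume "1 \<le> count_list l (Plain (2*t + 1))"
    from m(2)[OF _ this] k show "count_list l (Plain (2*t + 2)) + 2 \<le> k" by simp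
  qed
  ultimately show "l \<in> F_marked k N i"
    using R unfolding F_marked_def F_set_def O_set_def by blast
qed (auto simp: F_marked_def F_set_def O_set_def)

lemma shift_F_marked:
  assumes k: "2 \<le> k" and sh: "shift P s T"
    and l: "sorted l" "mset l = lowered P s T" and l': "sorted l'" "mset l' = raised P T"
  shows "l \<in> F_marked k N i \<longleftrightarrow> l' \<in> F_marked k N i"
proof -
  have op: "overpartition l" "overpartition l'"
    using sh shiftD(7)[OF sh] l l' by (simp_all add: overpartition_iff shift_def)
  have "has_first (mset l)" "has_first (mset l')"
    using sh shift_has_first[OF sh] l l' by (simp_all add: shift_def)
  then have "F_part (hd l)" "F_part (hd l')" using has_first_iff[OF l(1)] has_first_iff[OF l'(1)] by blast+
  moreover have "length l = length l'" using shift_size[OF sh] l l' by (metis size_mset)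
  moreover have "count_list l (Overlined 1) = count_list l' (Overlined 1)"
    "count_list l (Plain 2) = count_list l' (Plain 2)"
    using shift_small_parts[OF sh] l(2) l'(2) by (metis count_mset)+
  moreover have "count_list (GG_marking l) r = count_list (GG_marking l') r" if "1 \<le> r" for r
    by (rule marking_count_eq[OF shift_marked[OF sh l l'] that])
  ultimately show ?thesis using op unfolding F_marked_iff[OF k] by auto
qed

text \<open>For \<open>r = 1\<close> the greedy selection picks exactly the tail of the smallest
  part: in each column the choice depends on the smaller sizes only through whether 2u was
  picked.\<close>

lemma regular_idx:
  assumes l: "overpartition l" "l \<noteq> []" and F: "\<forall>x\<in>set l. F_part x"
  shows "idx (mset l) = length (filter (\<lambda>m. m \<le> 1) (GG_marking l))"
proof -
  let ?f = "count_list l"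
  have "mset l \<noteq> {#}" using l by simp
  then obtain v T where v: "is_base (mset l) v" and T: "is_tail (mset l) v T"
    using is_base_exists is_tail_exists by blast
  have vm: "v \<in> set l" "\<forall>y\<in>set l. v \<le> y" using v F unfolding is_base_def by auto
  have fin: "finite T" and sp: "spread T" using T by (simp_all add: is_tail_def)
  have cover: "\<exists>x\<in>T. x \<le> psize y \<and> psize y < nx x" if "y \<in> set l" for y
  proof (cases "y = v")
    case True
    then show ?thesis using T nx_gt[of "psize v"] unfolding is_tail_def by (intro bexI[of _ "psize v"]) auto
  next
    case False
    then have "v < y" using vm that by fastforce
    then show ?thesis using T that unfolding is_tail_def by auto
  qed
  have mem: "reg x \<in> set l" if "x \<in> T" for x
  proof (cases "x = psize v")
    case True
    then show ?thesis using vm(1) F by (metis F_part_iff)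
  next
    case False
    then show ?thesis using tail_elem[OF T that] by auto
  qed
  have irr0: "?f (irr n) = 0" for n using F F_part_irr by (auto simp: count_list_0_iff)
  have reg0: "0 < ?f (reg n)" if "n \<in> T" for n using mem[OF that] by (metis count_list_0_iff gr0I)
  have regD: "n \<in> T \<or> (\<exists>x\<in>T. x < n \<and> n < nx x)" if "0 < ?f (reg n)" for n
  proof -
    have "reg n \<in> set l" using that by (metis count_list_0_iff less_irrefl)
    then show ?thesis using cover by (metis le_neq_implies_less psize_reg)
  qed
  have spD: "x \<in> T \<Longrightarrow> y \<in> T \<Longrightarrow> x < y \<Longrightarrow> nx x \<le> y" for x y
    using sp unfolding spread_def by blast
  have o1: "?f (Overlined t) \<le> 1" for t using l(1) by (simp add: overpartition_def)
  have step: "kept_overlined 1 ?f u = (if 2*u+1 \<in> T then 1 else 0) \<and> kept_plain 1 ?f u = (if 2*u+2 \<in> T then 1 else 0)"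
    if c: "kept_even 1 ?f u = (if 2*u \<in> T then 1 else 0)" for u
  proof -
    have n: "\<not> (2*u \<in> T \<and> 2*u+1 \<in> T)" "\<not> (2*u \<in> T \<and> 2*u+2 \<in> T)" "\<not> (2*u+1 \<in> T \<and> 2*u+2 \<in> T)"
      using spD[of "2*u" "2*u+1"] spD[of "2*u" "2*u+2"] spD[of "2*u+1" "2*u+2"] by (auto simp: nx_def)
    have a: "0 < ?f (reg (2*u+1)) \<longleftrightarrow> 2*u+1 \<in> T" if "2*u \<notin> T"
    proof
      assume "0 < ?f (reg (2*u+1))"
      then show "2*u+1 \<in> T"
      proof (rule regD[THEN disjE])
        assume "\<exists>x\<in>T. x < 2*u+1 \<and> 2*u+1 < nx x"
        then obtain x where x: "x \<in> T" "x < 2*u+1" "2*u+1 < nx x" by blast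
        then have "x = 2*u" unfolding nx_def by presburger
        then show ?thesis using x \<open>2*u \<notin> T\<close> by simp
      qed
    qed (rule reg0)
    have b: "0 < ?f (reg (2*u+2)) \<longleftrightarrow> 2*u+2 \<in> T" if "2*u \<notin> T" "2*u+1 \<notin> T"
    proof
      assume "0 < ?f (reg (2*u+2))"
      then show "2*u+2 \<in> T"
      proof (rule regD[THEN disjE])
        assume "\<exists>x\<in>T. x < 2*u+2 \<and> 2*u+2 < nx x"
        then obtain x where x: "x \<in> T" "x < 2*u+2" "2*u+2 < nx x" by blast
        then have "x = 2*u \<or> x = 2*u+1" unfolding nx_def by presburger
        then show ?thesis using x \<open>2*u \<notin> T\<close> \<open>2*u+1 \<notin> T\<close> by auto
      qed
    qed (rule reg0)
    have a1: "?f (reg (2*u+1)) \<le> 1" using o1[of "2*u+1"] unfolding column_parts .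
    have ko: "kept_overlined 1 ?f u = (if 2*u+1 \<in> T then 1 else 0)"
      unfolding kept_overlined_def column_parts c using n(1) a a1 by auto
    show ?thesis
      unfolding ko kept_plain_def column_parts c irr0 using n b by auto
  qed
  have c: "kept_even 1 ?f u = (if 2*u \<in> T then 1 else 0)" for u
  proof (induction u)
    case 0
    have "0 \<notin> T" using mem l(1) unfolding overpartition_def by fastforce
    then show ?case by simp
  next
    case (Suc u)
    then show ?case unfolding kept_even_Suc column_parts irr0 using step[of u] by simp
  qed
  have sum: "(\<Sum>w<u. kept 1 ?f w) = card {x\<in>T. x \<le> 2*u}" for u
  proof (induction u)
    case 0
    have "0 \<notin> T" using mem l(1) unfolding overpartition_def by fastforce
    then have "{x\<in>T. x \<le> 2*0} = {}" by auto
    then show ?case by (simp only: card.empty lessThan_0 sum.empty)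
  next
    case (Suc u)
    have "{x\<in>T. x \<le> 2 * Suc u} = {x\<in>T. x \<le> 2*u} \<union> ({2*u+1} \<inter> T) \<union> ({2*u+2} \<inter> T)"
      by (auto simp: le_Suc_eq)
    moreover have "card ({x\<in>T. x \<le> 2*u} \<union> ({2*u+1} \<inter> T) \<union> ({2*u+2} \<inter> T))
        = card {x\<in>T. x \<le> 2*u} + card ({2*u+1} \<inter> T) + card ({2*u+2} \<inter> T)"
      using fin by (subst card_Un_disjoint, simp, simp, force)+ simp
    moreover have "kept 1 ?f u = (if 2*u+1 \<in> T then 1 else 0) + (if 2*u+2 \<in> T then 1 else 0)"
      unfolding kept_def column_parts irr0 using step[OF c] by simp
    ultimately show ?case using Suc by simp
  qed
  obtain u where u: "\<forall>n \<in> psize ` set l \<union> T. n \<le> u"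
    using finite_nat_set_iff_bounded_le[of "psize ` set l \<union> T"] fin by auto
  have u': "x \<in> set l \<Longrightarrow> psize x \<le> u" "n \<in> T \<Longrightarrow> n \<le> u" for x n using u by blast+
  have "{x\<in>T. x \<le> 2*u} = T" by (auto dest: u'(2))
  then have "(\<Sum>w<u. kept 1 ?f w) = card T" unfolding sum by simp
  moreover have "\<forall>x\<in>set l. psize x \<le> 2*u" by (auto dest: u'(1))
  then have "length (filter (\<lambda>m. m \<le> 1) (GG_marking l)) = (\<Sum>w<u. kept 1 ?f w)"
    using marked_total[OF l(1), of u 1] by simp
  ultimately show ?thesis using idx_eq[OF v T] by simp
qed

lemma base_irregular: "is_base M v \<Longrightarrow> \<not> (\<forall>y\<in>#M. F_part y) \<Longrightarrow> \<not> F_part v"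
  unfolding is_base_def by (simp only: if_False not_False_eq_True)

text \<open>Each step removes an irregular part and strictly increases the index, which equals
  \<open>N 1\<close> once none is left.\<close>

lemma idx_le_first:
  assumes k: "2 \<le> k" and l: "l \<in> F_marked k N i" "l \<noteq> []"
  shows "if \<forall>x\<in>set l. F_part x then idx (mset l) = N 1 else idx (mset l) < N 1"
  using l
proof (induction "size {#x \<in># mset l. \<not> F_part x#}" arbitrary: l rule: less_induct)
  case less
  have op: "overpartition l" and so: "sorted l" using less.prems unfolding F_marked_iff[OF k] overpartition_iff by blast+
  show ?case
  proof (cases "\<forall>x\<in>set l. F_part x")
    case True
    have "length (filter (\<lambda>m. m \<le> 1) (GG_marking l)) = count_list (GG_marking l) 1"
      using length_filter_Suc[of 0 "GG_marking l"] mark_pos[of l] unfolding length_filter_marking by simp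
    moreover have "count_list (GG_marking l) 1 = N 1" using less.prems k unfolding F_marked_iff[OF k] by auto
    ultimately show ?thesis using regular_idx[OF op less.prems(2) True] True by simp
  next
    case False
    have "op_mset (mset l)" "has_first (mset l)"
      using op less.prems k unfolding F_marked_iff[OF k] overpartition_iff has_first_iff[OF so] by blast+
    moreover have "mset l \<noteq> {#}" using less.prems by simp
    then obtain v where v: "is_base (mset l) v" using is_base_exists by blast
    moreover have "\<not> F_part v" using base_irregular[OF v] False by simp
    ultimately obtain P T where sh: "shift P (psize v) T" "mset l = lowered P (psize v) T" "card T = idx (mset l)"
      using shift_exists_raise by blast
    define l' where "l' = sorted_list_of_multiset (raised P T)"
    have l': "sorted l'" "mset l' = raised P T" by (simp_all add: l'_def)
    have "l' \<in> F_marked k N i" using shift_F_marked[OF k sh(1) so sh(2) l'] less.prems by blast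
    moreover have "l' \<noteq> []" using shift_size[OF sh(1)] sh(2) l'(2) less.prems(2)
      by (metis size_eq_0_iff_empty mset_zero_iff)
    moreover have "size {#x \<in># mset l'. \<not> F_part x#} < size {#x \<in># mset l. \<not> F_part x#}"
      using shift_irregular[OF sh(1)] unfolding l'(2) sh(2) by simp
    ultimately have "idx (mset l') \<le> N 1" using less.hyps[of l'] by (auto split: if_splits)
    then show ?thesis using shift_idx_raised[OF sh(1)] False unfolding l'(2)[symmetric] sh(3) by simp
  qed
qed

section \<open>Composing the steps\<close>

lemma bij_betw_of_relation:
  assumes "\<And>a. a \<in> A \<Longrightarrow> \<exists>b\<in>B. R a b" "\<And>b. b \<in> B \<Longrightarrow> \<exists>a\<in>A. R a b"
    and "\<And>a b b'. R a b \<Longrightarrow> R a b' \<Longrightarrow> b = b'" "\<And>a a' b. R a b \<Longrightarrow> R a' b \<Longrightarrow> a = a'"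
  shows "\<exists>h. bij_betw h A B \<and> (\<forall>a\<in>A. R a (h a))"
proof -
  obtain h where h: "\<And>a. a \<in> A \<Longrightarrow> h a \<in> B \<and> R a (h a)" using assms(1) by metis
  have "inj_on h A" by (rule inj_onI) (metis h assms(4))
  moreover have "h ` A = B"
  proof
    show "B \<subseteq> h ` A"
    proof
      fix b assume "b \<in> B"
      then obtain a where "a \<in> A" "R a b" using assms(2) by blast
      then show "b \<in> h ` A" using h assms(3) by (metis imageI)
    qed
  qed (use h in blast)
  ultimately show ?thesis using h unfolding bij_betw_def by blast
qed

text \<open>\<open>B (j - 1) - B j\<close> collects the overpartitions with index exactly
  \<open>j\<close>. Treating the step as a relation \<open>R\<close> lets totality in both
  directions come from the existence lemmas and injectivity and single-valuedness from the
  uniqueness lemmas; sorting leads back from multisets to lists.\<close>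

lemma raise_step:
  fixes k i :: nat and N :: "nat \<Rightarrow> nat"
  assumes k: "2 \<le> k" and N1: "1 \<le> N 1" and j: "1 \<le> j" "j \<le> N 1 - 1"
  defines "B \<equiv> \<lambda>j. {l \<in> F_marked k N i. j < idx (mset l)}"
  shows "\<exists>h. bij_betw h (B (j - 1) - B j) (B j) \<and>
    (\<forall>l\<in>B (j - 1) - B j. weight (h l) = weight l + 2 * j)"
proof -
  let ?A = "B (j - 1) - B j"
  define R where "R l l' \<longleftrightarrow> sorted l \<and> sorted l' \<and>
    (\<exists>P s T. shift P s T \<and> mset l = lowered P s T \<and> mset l' = raised P T \<and> card T = j)" for l l'
  have A: "l \<in> ?A \<longleftrightarrow> l \<in> F_marked k N i \<and> idx (mset l) = j" for l
    using j by (auto simp: B_def)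
  have facts: "sorted l" "op_mset (mset l)" "l \<noteq> [] \<Longrightarrow> has_first (mset l)" "l \<noteq> []"
    if l: "l \<in> F_marked k N i" for l
  proof -
    show so: "sorted l" and "op_mset (mset l)"
      using l unfolding F_marked_iff[OF k] overpartition_iff by blast+
    show "l \<noteq> [] \<Longrightarrow> has_first (mset l)"
      using l unfolding F_marked_iff[OF k] has_first_iff[OF so] by blast
    have "count_list (GG_marking l) 1 = N 1" using l k unfolding F_marked_iff[OF k] by auto
    then show "l \<noteq> []" using N1 by (auto simp: GG_marking_def)
  qed
  have "\<exists>h. bij_betw h ?A (B j) \<and> (\<forall>a\<in>?A. R a (h a))"
  proof (rule bij_betw_of_relation)
    fix l assume "l \<in> ?A"
    then have l: "l \<in> F_marked k N i" "idx (mset l) = j" using A by blast+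
    note fl = facts[OF l(1)]
    have "mset l \<noteq> {#}" using fl(4) by simp
    then obtain v where v: "is_base (mset l) v" using is_base_exists by blast
    \<comment> \<open>Without irregular parts the index would be \<open>N 1\<close>, but
      \<open>j < N 1\<close>.\<close>
    have "\<not> (\<forall>x\<in>set l. F_part x)"
      using idx_le_first[OF k l(1) fl(4)] l(2) j N1 by (auto split: if_splits)
    then have nF: "\<not> F_part v" using base_irregular[OF v] by simp
    obtain P T where sh: "shift P (psize v) T" "mset l = lowered P (psize v) T" "card T = idx (mset l)"
      using shift_exists_raise[OF fl(2) fl(3)[OF fl(4)] v nF] by blast
    define l' where "l' = sorted_list_of_multiset (raised P T)"
    have l': "sorted l'" "mset l' = raised P T" by (simp_all add: l'_def)
    have "l' \<in> F_marked k N i" using shift_F_marked[OF k sh(1) fl(1) sh(2) l'] l(1) by blast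
    moreover have "j < idx (mset l')" using shift_idx_raised[OF sh(1)] sh(3) l(2) l'(2) by simp
    moreover have "R l l'" unfolding R_def using fl(1) sh l' l(2) by metis
    ultimately show "\<exists>l'\<in>B j. R l l'" unfolding B_def by blast
  next
    fix l' assume "l' \<in> B j"
    then have l': "l' \<in> F_marked k N i" "j < idx (mset l')" by (simp_all add: B_def)
    note fl = facts[OF l'(1)]
    obtain P s T where sh: "shift P s T" "mset l' = raised P T" "card T = j"
      using shift_exists_lower[OF fl(2) fl(3)[OF fl(4)] j(1) l'(2)] by blast
    define l where "l = sorted_list_of_multiset (lowered P s T)"
    have l: "sorted l" "mset l = lowered P s T" by (simp_all add: l_def)
    have "l \<in> F_marked k N i" using shift_F_marked[OF k sh(1) l fl(1) sh(2)] l'(1) by blast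
    moreover have "idx (mset l) = j"
      using idx_eq[OF shift_idx_lowered[OF sh(1)]] sh(3) l(2) by simp
    moreover have "R l l'" unfolding R_def using fl(1) sh l by blast
    ultimately show "\<exists>l\<in>?A. R l l'" using A by blast
  next
    fix l m m' assume "R l m" "R l m'"
    then have "sorted m" "sorted m'" "mset m = mset m'"
      unfolding R_def using shift_raise_unique by metis+
    then show "m = m'" by (metis properties_for_sort)
  next
    fix l l' m assume "R l m" "R l' m"
    then have "sorted l" "sorted l'" "mset l = mset l'"
      unfolding R_def using shift_lower_unique by metis+
    then show "l = l'" by (metis properties_for_sort)
  qed
  moreover have "weight l' = weight l + 2 * j" if "R l l'" for l l'
    using that unfolding R_def mset_sum[symmetric] using shift_weight by metis
  ultimately show ?thesis by blast
qed

lemma R_set_0: "R_set (int 0) = {{}}" and R_set_minus_1: "R_set (-1) = {{}}"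
  by (force simp: R_set_def)+

lemma R_set_Suc: "R_set (int (Suc n)) = R_set (int n) \<union> insert (- 2 * int (Suc n)) ` R_set (int n)"
proof (intro equalityI subsetI)
  fix \<tau> assume \<tau>: "\<tau> \<in> R_set (int (Suc n))"
  let ?c = "- 2 * int (Suc n)"
  have "\<tau> - {?c} \<in> R_set (int n)"
    unfolding R_set_def
  proof (intro CollectI conjI ballI)
    show "finite (\<tau> - {?c})" using \<tau> by (simp add: R_set_def)
    fix x assume x: "x \<in> \<tau> - {?c}"
    then have e: "even x" "?c \<le> x" "x \<le> -2" "x \<noteq> ?c" using \<tau> by (auto simp: R_set_def)
    then show "even x" "x \<le> -2" by simp_all
    show "- 2 * int n \<le> x" using e by (auto elim!: evenE)
  qed
  then show "\<tau> \<in> R_set (int n) \<union> insert ?c ` R_set (int n)"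
    by (cases "?c \<in> \<tau>") (auto intro!: image_eqI[of _ _ "\<tau> - {?c}"])
qed (auto simp: R_set_def)

lemma R_set_notin: "\<tau> \<in> R_set (int n) \<Longrightarrow> - 2 * int (Suc n) \<notin> \<tau>"
  by (auto simp: R_set_def)

lemma R_set_finite: "\<tau> \<in> R_set n \<Longrightarrow> finite \<tau>"
  by (simp add: R_set_def)

text \<open>\<open>B n\<close> consists of \<open>B (Suc n)\<close> and a set that \<open>h\<close>
  maps bijectively to \<open>B (Suc n)\<close>, hence of two copies of it. Which copy is meant is
  recorded by the presence of \<open>- 2 * int (Suc n)\<close> in the set, and this element also
  pays for the weight that \<open>h\<close> adds.\<close>

lemma compose_steps:
  fixes B :: "nat \<Rightarrow> 'a set" and w :: "'a \<Rightarrow> nat"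
  assumes "\<And>j. 1 \<le> j \<Longrightarrow> j \<le> n \<Longrightarrow> B j \<subseteq> B (j - 1)"
    and "\<And>j. 1 \<le> j \<Longrightarrow> j \<le> n \<Longrightarrow> \<exists>h. bij_betw h (B (j - 1) - B j) (B j) \<and>
      (\<forall>x\<in>B (j - 1) - B j. w (h x) = w x + 2 * j)"
  shows "\<exists>\<Phi>. bij_betw \<Phi> (B 0) (R_set (int n) \<times> B n) \<and>
    (\<forall>x\<in>B 0. \<forall>\<tau> y. \<Phi> x = (\<tau>, y) \<longrightarrow> int (w x) = \<Sum>\<tau> + int (w y))"
  using assms
proof (induction n)
  case 0
  show ?case by (rule exI[of _ "\<lambda>x. ({}, x)"]) (auto simp: R_set_0[simplified] bij_betw_def inj_on_def)
next
  case (Suc n)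
  let ?c = "- 2 * int (Suc n)"
  obtain \<Phi> where \<Phi>: "bij_betw \<Phi> (B 0) (R_set (int n) \<times> B n)"
    "\<And>x \<tau> y. x \<in> B 0 \<Longrightarrow> \<Phi> x = (\<tau>, y) \<Longrightarrow> int (w x) = \<Sum>\<tau> + int (w y)"
    using Suc.IH Suc.prems by (metis le_SucI)
  have sub: "B (Suc n) \<subseteq> B n" using Suc.prems(1)[of "Suc n"] by simp
  obtain h where h: "bij_betw h (B n - B (Suc n)) (B (Suc n))"
    "\<And>x. x \<in> B n - B (Suc n) \<Longrightarrow> w (h x) = w x + 2 * Suc n"
    using Suc.prems(2)[of "Suc n"] by auto
  define g where "g = (\<lambda>(\<tau>, y). if y \<in> B (Suc n) then (\<tau>, y) else (insert ?c \<tau>, h y))"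
  have hB: "h y \<in> B (Suc n)" if "y \<in> B n - B (Suc n)" for y using h(1) that bij_betwE by blast
  have "bij_betw g (R_set (int n) \<times> B n) (R_set (int (Suc n)) \<times> B (Suc n))"
    unfolding bij_betw_def
  proof
    show "inj_on g (R_set (int n) \<times> B n)"
    proof (rule inj_onI)
      fix p q assume p: "p \<in> R_set (int n) \<times> B n" and q: "q \<in> R_set (int n) \<times> B n" and eq: "g p = g q"
      obtain \<tau> y \<sigma> z where pq: "p = (\<tau>, y)" "q = (\<sigma>, z)" by (metis surj_pair)
      have c: "?c \<notin> \<tau>" "?c \<notin> \<sigma>" using p q pq R_set_notin by blast+
      have inj: "inj_on h (B n - B (Suc n))" using h(1) by (simp add: bij_betw_def)
      show "p = q"
      proof (cases "y \<in> B (Suc n)"; cases "z \<in> B (Suc n)")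
        assume "y \<in> B (Suc n)" "z \<in> B (Suc n)"
        then show ?thesis using eq pq by (simp add: g_def)
      next
        assume "y \<in> B (Suc n)" "z \<notin> B (Suc n)"
        then have "\<tau> = insert ?c \<sigma>" using eq pq by (simp add: g_def)
        then show ?thesis using c by blast
      next
        assume "y \<notin> B (Suc n)" "z \<in> B (Suc n)"
        then have "\<sigma> = insert ?c \<tau>" using eq pq by (simp add: g_def)
        then show ?thesis using c by blast
      next
        assume yz: "y \<notin> B (Suc n)" "z \<notin> B (Suc n)"
        then have "insert ?c \<tau> = insert ?c \<sigma>" "h y = h z" using eq pq by (simp_all add: g_def)
        then have "\<tau> = \<sigma>" "y = z"
          using insert_ident[OF c] inj_onD[OF inj, of y z] yz p q pq by simp_all
        then show ?thesis using pq by simp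
      qed
    qed
    show "g ` (R_set (int n) \<times> B n) = R_set (int (Suc n)) \<times> B (Suc n)"
    proof (intro equalityI subsetI)
      fix p assume "p \<in> g ` (R_set (int n) \<times> B n)"
      then obtain \<tau> y where "\<tau> \<in> R_set (int n)" "y \<in> B n" "p = g (\<tau>, y)" by blast
      then show "p \<in> R_set (int (Suc n)) \<times> B (Suc n)"
        unfolding R_set_Suc g_def using hB[of y] by (cases "y \<in> B (Suc n)") simp_all
    next
      fix p assume "p \<in> R_set (int (Suc n)) \<times> B (Suc n)"
      then obtain \<tau> y where p: "p = (\<tau>, y)" "\<tau> \<in> R_set (int (Suc n))" "y \<in> B (Suc n)" by blast
      show "p \<in> g ` (R_set (int n) \<times> B n)"
      proof (cases "\<tau> \<in> R_set (int n)")
        case True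
        then have "p = g (\<tau>, y)" "(\<tau>, y) \<in> R_set (int n) \<times> B n" using p sub by (simp_all add: g_def subsetD)
        then show ?thesis by blast
      next
        case False
        then obtain \<sigma> where \<sigma>: "\<sigma> \<in> R_set (int n)" "\<tau> = insert ?c \<sigma>" using p(2) unfolding R_set_Suc by blast
        have "y \<in> h ` (B n - B (Suc n))" using bij_betw_imp_surj_on[OF h(1)] p(3) by simp
        then obtain z where z: "z \<in> B n - B (Suc n)" "h z = y" by (elim imageE) simp
        then have "p = g (\<sigma>, z)" "(\<sigma>, z) \<in> R_set (int n) \<times> B n" using p(1) \<sigma> z by (simp_all add: g_def)
        then show ?thesis by blast
      qed
    qed
  qed
  then have "bij_betw (g \<circ> \<Phi>) (B 0) (R_set (int (Suc n)) \<times> B (Suc n))" by (rule bij_betw_trans[OF \<Phi>(1)])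
  moreover have "int (w x) = \<Sum>\<tau> + int (w y)" if x: "x \<in> B 0" "(g \<circ> \<Phi>) x = (\<tau>, y)" for x \<tau> y
  proof -
    obtain \<sigma> z where \<sigma>: "\<Phi> x = (\<sigma>, z)" by (metis surj_pair)
    then have mem: "\<sigma> \<in> R_set (int n)" "z \<in> B n" using bij_betwE[OF \<Phi>(1)] x(1) by force+
    have wx: "int (w x) = \<Sum>\<sigma> + int (w z)" by (rule \<Phi>(2)[OF x(1) \<sigma>])
    show ?thesis
    proof (cases "z \<in> B (Suc n)")
      case True
      then show ?thesis using x(2) \<sigma> wx by (simp add: g_def)
    next
      case False
      then have "\<tau> = insert ?c \<sigma>" "y = h z" using x(2) \<sigma> by (simp_all add: g_def)
      moreover have "\<Sum>(insert ?c \<sigma>) = ?c + \<Sum>\<sigma>"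
        using R_set_notin[OF mem(1)] R_set_finite[OF mem(1)] by simp
      ultimately show ?thesis using wx h(2)[of z] mem(2) False by simp
    qed
  qed
  ultimately show ?case by blast
qed

lemma G_marked_iff: "l \<in> G_marked k N i \<longleftrightarrow> l \<in> F_marked k N i \<and> (\<forall>x\<in>set l. F_part x)"
  unfolding G_marked_def F_part_def by auto

theorem theorem4p1:
  fixes k i :: nat and N :: "nat \<Rightarrow> nat"
  assumes "1 \<le> i" and "i \<le> k"
    and "\<forall>r. 1 \<le> r \<and> r + 1 \<le> k - 1 \<longrightarrow> N (r + 1) \<le> N r"
    and "k = 1 \<longrightarrow> N 1 = 0"
  shows "\<exists>\<Phi>. bij_betw \<Phi> (F_marked k N i) (R_set (int (N 1) - 1) \<times> G_marked k N i)
           \<and> (\<forall>l \<in> F_marked k N i. \<forall>\<tau> \<mu>. \<Phi> l = (\<tau>, \<mu>) \<longrightarrow>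
                int (weight l) = \<Sum>\<tau> + int (weight \<mu>))"
proof (cases "N 1 = 0")
  case True
  \<comment> \<open>A first part always has mark 1, so for \<open>N 1 = 0\<close> at most the empty
    overpartition remains, paired with the empty set.\<close>
  have nil: "l = []" if l: "l \<in> F_marked k N i" for l
  proof (cases "k = 1")
    case True
    then show ?thesis using l by (auto simp: F_marked_def F_set_def O_set_def)
  next
    case False
    show ?thesis
    proof (rule ccontr)
      assume "l \<noteq> []"
      then have "mark l 0 \<in> set (GG_marking l)" by (simp add: GG_marking_def marks_upto_eq)
      then have "1 \<in> set (GG_marking l)" by (simp add: mark_unfold)
      then have "count_list (GG_marking l) 1 \<noteq> 0" by (simp add: count_list_0_iff)
      then show False using l False assms(1,2) \<open>N 1 = 0\<close> unfolding F_marked_def by auto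
    qed
  qed
  have "G_marked k N i = F_marked k N i"
    using nil unfolding set_eq_iff G_marked_iff by (metis empty_iff list.set(1))
  then show ?thesis using True
    by (intro exI[of _ "\<lambda>l. ({}, l)"]) (auto simp: R_set_minus_1 bij_betw_def inj_on_def)
next
  case False
  then have N1: "1 \<le> N 1" by simp
  then have k: "2 \<le> k" using assms by (cases "k = 1") auto
  define B where "B = (\<lambda>j. {l \<in> F_marked k N i. j < idx (mset l)})"
  have ne: "l \<noteq> []" if l: "l \<in> F_marked k N i" for l
  proof -
    have "count_list (GG_marking l) 1 = N 1" using l k unfolding F_marked_def by auto
    then show ?thesis using N1 by (auto simp: GG_marking_def)
  qed
  have B0: "B 0 = F_marked k N i"
  proof -
    have "0 < idx (mset l)" if "l \<in> F_marked k N i" for l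
    proof -
      have "mset l \<noteq> {#}" using ne[OF that] by simp
      then obtain v T where "is_base (mset l) v" "is_tail (mset l) v T"
        using is_base_exists is_tail_exists by blast
      then show ?thesis using idx_eq[of "mset l" v T] by (auto simp: is_tail_def card_gt_0_iff)
    qed
    then show ?thesis by (auto simp: B_def)
  qed
  \<comment> \<open>By \<open>idx_le_first\<close> the index exceeds \<open>N 1 - 1\<close> exactly
    when no irregular part is left.\<close>
  have BN: "B (N 1 - 1) = G_marked k N i"
    using idx_le_first[OF k _ ne] N1 by (fastforce simp: B_def G_marked_iff split: if_splits)
  have "\<exists>\<Phi>. bij_betw \<Phi> (B 0) (R_set (int (N 1 - 1)) \<times> B (N 1 - 1)) \<and>
    (\<forall>x\<in>B 0. \<forall>\<tau> y. \<Phi> x = (\<tau>, y) \<longrightarrow> int (weight x) = \<Sum>\<tau> + int (weight y))"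
  proof (rule compose_steps)
    fix j assume j: "1 \<le> j" "j \<le> N 1 - 1"
    show "B j \<subseteq> B (j - 1)" by (auto simp: B_def)
    show "\<exists>h. bij_betw h (B (j - 1) - B j) (B j) \<and> (\<forall>x\<in>B (j - 1) - B j. weight (h x) = weight x + 2 * j)"
      unfolding B_def by (rule raise_step[of k N j i, OF k N1 j])
  qed
  moreover have "int (N 1 - 1) = int (N 1) - 1" using N1 by simp
  ultimately show ?thesis unfolding B0 BN by simp
qed

end
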